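(* Let $K$ be a p.c.f. self-similar set generated by an IFS $F_i(x)=\rho(x-b_i)+b_i$, $1\le i\le N$, on $\mathbb R^d$ with $0<\rho<1$, and let $\sim$ be a compatible relation on $V_0$. Let $J$ be a boundary class in $V_*$ and let $\gamma$ be the Hausdorff dimension of $\overline J$. Suppose there exist $p,q\in V_0$, $p\ne q$, such that $R:=R(p,q)<\rho^{-(2-\gamma)}$. Then for any Lipschitz function $u$ on $\overline J$, $$\sup_{n\ge0}R^nE_{J,n}(u)<\infty .$$ Furthermore, if $\mathcal H^\gamma(\overline J)<\infty$ (with $\mathcal H^\gamma$ the $\gamma$-dimensional Hausdorff measure), then the condition can be relaxed to $R\le\rho^{-(2-\gamma)}$ and the same conclusion holds.
   Context: **P.c.f. setting.** $K=\bigcup_{i=1}^NF_i(K)$ is the nonempty compact self-similar set, assumed connected. For a word $\omega=\omega_1\cdots\omega_n\in\{1,\dots,N\}^n$, $|\omega|=n$, put $F_\omega=F_{\omega_1}\circ\cdots\circ F_{\omega_n}$, $K_\omega=F_\omega(K)$. Let $\pi:\{1,\dots,N\}^{\infty}\to K$ be $\{\pi(\omega)\}=\bigcap_nK_{\omega_1\cdots\omega_n}$, $\tau$ the left shift, $\mathcal C=\pi^{-1}(\bigcup_{i<j}(K_i\cap K_j))$ and $\mathcal P=\bigcup_{m\ge1}\tau^m(\mathcal C)$. The IFS (and $K$) is p.c.f. if $\mathcal P$ is finite. The boundary is $V_0=\pi(\mathcal P)$, assumed to have at least two points; $V_n=\bigcup_iF_i(V_{n-1})$, $V_*=\bigcup_nV_n$,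 and $V_\omega=F_\omega(V_0)$, $|\omega|=n$, is an $n$-cell. **Primal energy and traces.** For $u:V_n\to\mathbb R$, $E_n[u]=\sum_{|\omega|=n}\sum_{\{x,y\}\subset V_\omega}|u(x)-u(y)|^2$ (unordered pairs). The trace $R_n(p,q)$, $p\neq q\in V_0$, is defined by: for all $u:V_0\to\mathbb R$, $\min\{E_n[v]: v:V_n\to\mathbb R,\ v|_{V_0}=u\}=\sum_{\{p,q\}\subset V_0}\frac1{R_n(p,q)}|u(p)-u(q)|^2$. An increasing sequence $(R_n)$ of positive reals has asymptotic geometric growth rate $R>1$ if for every $\varepsilon>0$ there is $N(\varepsilon)$ with $R^{(1-\varepsilon)n}\le R_n\le R^{(1+\varepsilon)n}$ for all $n\ge N(\varepsilon)$; $R(p,q)$ denotes the rate of $(R_n(p,q))_n$ (if it exists). **Compatible relations.** Let $\sim\,=\,\sim_0$ be an equivalence relation on $V_0$ with at least two classes. Let $\sim_n$ be the smallest equivalence relation on $V_n$ such that (1) $x\sim_{n-1}y$ in $V_{n-1}$ implies $x\sim_ny$; (2) $x\sim_{n-1}y$ in $V_{n-1}$ implies $F_i(x)\sim_nF_i(y)$ for $1\le i\le N$. The relation $\sim$ is compatible if for all $n\ge0$ and $x,y\in V_n$: $x\sim_ny$ iff $x\sim_{n+1}y$. It then induces an equivalence relation on $V_*$ ($x\sim y$ iff $x\sim_ny$ for $n$ with $x,y\in V_n$). A class $J$ of $V_*$ is a boundary class if $J\cap V_0\neq\emptyset$. For a class $J$ and $u$ defined on $J$, $E_{J,n}(u)=\sum_{|\omega|=n}\sum_{\{x,y\}\subset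 J\cap V_\omega}|u(x)-u(y)|^2$. *)

theory Defs
  imports "HOL-Analysis.Analysis"
begin

section \<open>Hausdorff measure and dimension\<close>

text \<open>
  The case distinction implements the conventions \<open>diam({})^s = 0\<close> and \<open>diam(U)^0 = 1\<close> for nonempty
  \<open>U\<close> (needed because \<open>0 powr 0 = 0\<close>).  It is only used for bounded \<open>U\<close>, since \<open>diameter\<close> carries no
  information for unbounded sets.
\<close>

definition diam_powr :: "real \<Rightarrow> 'a::metric_space set \<Rightarrow> ennreal" where
  "diam_powr s U = (if U = {} then 0 else if s = 0 then 1 else ennreal (diameter U powr s))"

definition hausdorff_premeasure :: "real \<Rightarrow> real \<Rightarrow> 'a::metric_space set \<Rightarrow> ennreal" where
  "hausdorff_premeasure s \<delta> A =
     (INF U \<in> {U :: nat \<Rightarrow> 'a set. A \<subseteq> (\<Union>i. U i) \<and> (\<forall>i. bounded (U i) \<and> diameter (U i) \<le> \<delta>)}.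
        \<Sum>i. diam_powr s (U i))"

definition hausdorff_measure :: "real \<Rightarrow> 'a::metric_space set \<Rightarrow> ennreal" where
  "hausdorff_measure s A = (SUP \<delta> \<in> {0<..}. hausdorff_premeasure s \<delta> A)"

text \<open>
  Restricted to Euclidean spaces, where the set below is never empty (it contains every \<open>s > DIM('a)\<close>),
  so that a real-valued infimum is adequate.
\<close>

definition hausdorff_dim :: "'a::euclidean_space set \<Rightarrow> real" where
  "hausdorff_dim A = Inf {s. 0 \<le> s \<and> hausdorff_measure s A = 0}"


section \<open>Words, coding map and post-critical set\<close>

text \<open>
  Throughout, \<open>F\<close> and \<open>N\<close> describe the IFS \<open>F 1, ..., F N\<close> and \<open>K\<close> its self-similar set.
\<close>

definition words :: "nat \<Rightarrow> nat \<Rightarrow> nat list set" where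
  "words N n = {w. length w = n \<and> set w \<subseteq> {1..N}}"

definition word_map :: "(nat \<Rightarrow> 'a \<Rightarrow> 'a) \<Rightarrow> nat list \<Rightarrow> 'a \<Rightarrow> 'a" where
  "word_map F w = foldr (\<lambda>i g. F i \<circ> g) w id"

definition inf_words :: "nat \<Rightarrow> (nat \<Rightarrow> nat) set" where
  "inf_words N = {\<omega>. range \<omega> \<subseteq> {1..N}}"

definition shift :: "(nat \<Rightarrow> nat) \<Rightarrow> (nat \<Rightarrow> nat)" where
  "shift \<omega> = (\<lambda>k. \<omega> (Suc k))"

definition coding :: "(nat \<Rightarrow> 'a \<Rightarrow> 'a) \<Rightarrow> 'a set \<Rightarrow> (nat \<Rightarrow> nat) \<Rightarrow> 'a" where
  "coding F K \<omega> = (THE x. (\<Inter>n. word_map F (map \<omega> [0..<n]) ` K) = {x})"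

definition critical_set :: "(nat \<Rightarrow> 'a \<Rightarrow> 'a) \<Rightarrow> nat \<Rightarrow> 'a set \<Rightarrow> (nat \<Rightarrow> nat) set" where
  "critical_set F N K =
     {\<omega> \<in> inf_words N. coding F K \<omega> \<in> (\<Union>j\<in>{1..N}. \<Union>i\<in>{1..<j}. F i ` K \<inter> F j ` K)}"

definition postcritical_set :: "(nat \<Rightarrow> 'a \<Rightarrow> 'a) \<Rightarrow> nat \<Rightarrow> 'a set \<Rightarrow> (nat \<Rightarrow> nat) set" where
  "postcritical_set F N K = (\<Union>m\<in>{1..}. (shift ^^ m) ` critical_set F N K)"

definition pcf :: "(nat \<Rightarrow> 'a \<Rightarrow> 'a) \<Rightarrow> nat \<Rightarrow> 'a set \<Rightarrow> bool" where
  "pcf F N K \<longleftrightarrow> finite (postcritical_set F N K)"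

primrec V :: "(nat \<Rightarrow> 'a \<Rightarrow> 'a) \<Rightarrow> nat \<Rightarrow> 'a set \<Rightarrow> nat \<Rightarrow> 'a set" where
  "V F N K 0 = coding F K ` postcritical_set F N K"
| "V F N K (Suc n) = (\<Union>i\<in>{1..N}. F i ` V F N K n)"

definition Vstar :: "(nat \<Rightarrow> 'a \<Rightarrow> 'a) \<Rightarrow> nat \<Rightarrow> 'a set \<Rightarrow> 'a set" where
  "Vstar F N K = (\<Union>n. V F N K n)"

definition Vcell :: "(nat \<Rightarrow> 'a \<Rightarrow> 'a) \<Rightarrow> nat \<Rightarrow> 'a set \<Rightarrow> nat list \<Rightarrow> 'a set" where
  "Vcell F N K w = word_map F w ` V F N K 0"


section \<open>Energies, traces and growth rates\<close>

text \<open>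
  Sums over unordered pairs \<open>{x, y}\<close> of a finite set are written as half of the sum over all ordered
  pairs; the diagonal terms vanish.
\<close>

definition pair_energy :: "'a set \<Rightarrow> ('a \<Rightarrow> real) \<Rightarrow> real" where
  "pair_energy A u = (1/2) * (\<Sum>x\<in>A. \<Sum>y\<in>A. \<bar>u x - u y\<bar>\<^sup>2)"

definition primal_energy ::
  "(nat \<Rightarrow> 'a \<Rightarrow> 'a) \<Rightarrow> nat \<Rightarrow> 'a set \<Rightarrow> nat \<Rightarrow> ('a \<Rightarrow> real) \<Rightarrow> real" where
  "primal_energy F N K n u = (\<Sum>w\<in>words N n. pair_energy (Vcell F N K w) u)"

definition class_energy ::
  "(nat \<Rightarrow> 'a \<Rightarrow> 'a) \<Rightarrow> nat \<Rightarrow> 'a set \<Rightarrow> 'a set \<Rightarrow> nat \<Rightarrow> ('a \<Rightarrow> real) \<Rightarrow> real" where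
  "class_energy F N K J n u = (\<Sum>w\<in>words N n. pair_energy (J \<inter> Vcell F N K w) u)"

definition is_minimum :: "real set \<Rightarrow> real \<Rightarrow> bool" where
  "is_minimum S m \<longleftrightarrow> m \<in> S \<and> (\<forall>s\<in>S. m \<le> s)"

text \<open>
  \<open>r\<close> is the family of resistances of the trace of the level-\<open>n\<close> energy on \<open>V\<^sub>0\<close>.  Functions on \<open>V\<^sub>0\<close> and
  \<open>V\<^sub>n\<close> are represented by total functions, whose values elsewhere play no role.  A pair that is not
  joined by an edge of the trace network (infinite resistance) has \<open>r p q = 0\<close>, as \<open>1 / 0 = 0\<close>; such
  values are excluded by positivity wherever a growth rate is considered.
\<close>

definition is_trace ::
  "(nat \<Rightarrow> 'a \<Rightarrow> 'a) \<Rightarrow> nat \<Rightarrow> 'a set \<Rightarrow> nat \<Rightarrow> ('a \<Rightarrow> 'a \<Rightarrow> real) \<Rightarrow> bool" where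
  "is_trace F N K n r \<longleftrightarrow>
     (\<forall>p\<in>V F N K 0. \<forall>q\<in>V F N K 0. r p q = r q p) \<and>
     (\<forall>u :: 'a \<Rightarrow> real.
        is_minimum {primal_energy F N K n v |v. \<forall>x\<in>V F N K 0. v x = u x}
          ((1/2) * (\<Sum>p\<in>V F N K 0. \<Sum>q\<in>V F N K 0. 1 / r p q * \<bar>u p - u q\<bar>\<^sup>2)))"

text \<open>The off-diagonal coefficients of the trace are unique, so this is \<open>R\<^sub>n(p,q)\<close> for \<open>p \<noteq> q\<close> in \<open>V\<^sub>0\<close>.\<close>

definition trace_resistance ::
  "(nat \<Rightarrow> 'a \<Rightarrow> 'a) \<Rightarrow> nat \<Rightarrow> 'a set \<Rightarrow> nat \<Rightarrow> 'a \<Rightarrow> 'a \<Rightarrow> real" where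
  "trace_resistance F N K n p q = (THE t. \<exists>r. is_trace F N K n r \<and> r p q = t)"

definition has_growth_rate :: "(nat \<Rightarrow> real) \<Rightarrow> real \<Rightarrow> bool" where
  "has_growth_rate a R \<longleftrightarrow>
     incseq a \<and> (\<forall>n. 0 < a n) \<and> 1 < R \<and>
     (\<forall>\<epsilon>>0. \<exists>M. \<forall>n\<ge>M. R powr ((1 - \<epsilon>) * real n) \<le> a n \<and> a n \<le> R powr ((1 + \<epsilon>) * real n))"


section \<open>Compatible relations\<close>

primrec sim_level ::
  "(nat \<Rightarrow> 'a \<Rightarrow> 'a) \<Rightarrow> nat \<Rightarrow> 'a set \<Rightarrow> 'a rel \<Rightarrow> nat \<Rightarrow> 'a rel" where
  "sim_level F N K S 0 = S"
| "sim_level F N K S (Suc n) =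
     \<Inter>{T. equiv (V F N K (Suc n)) T \<and>
          (\<forall>x y. (x, y) \<in> sim_level F N K S n \<longrightarrow>
             (x, y) \<in> T \<and> (\<forall>i\<in>{1..N}. (F i x, F i y) \<in> T))}"

definition compatible :: "(nat \<Rightarrow> 'a \<Rightarrow> 'a) \<Rightarrow> nat \<Rightarrow> 'a set \<Rightarrow> 'a rel \<Rightarrow> bool" where
  "compatible F N K S \<longleftrightarrow>
     equiv (V F N K 0) S \<and> 2 \<le> card (V F N K 0 // S) \<and>
     (\<forall>n. \<forall>x\<in>V F N K n. \<forall>y\<in>V F N K n.
        (x, y) \<in> sim_level F N K S n \<longleftrightarrow> (x, y) \<in> sim_level F N K S (Suc n))"

definition sim_star :: "(nat \<Rightarrow> 'a \<Rightarrow> 'a) \<Rightarrow> nat \<Rightarrow> 'a set \<Rightarrow> 'a rel \<Rightarrow> 'a rel" where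
  "sim_star F N K S =
     {(x, y). \<exists>n. x \<in> V F N K n \<and> y \<in> V F N K n \<and> (x, y) \<in> sim_level F N K S n}"

definition boundary_class :: "(nat \<Rightarrow> 'a \<Rightarrow> 'a) \<Rightarrow> nat \<Rightarrow> 'a set \<Rightarrow> 'a rel \<Rightarrow> 'a set \<Rightarrow> bool" where
  "boundary_class F N K S J \<longleftrightarrow>
     J \<in> Vstar F N K // sim_star F N K S \<and> J \<inter> V F N K 0 \<noteq> {}"

end

theory Submission
  imports Defs
begin

text \<open>
A Lipschitz function varies by at most a constant times \<open>\<rho>^n\<close> on an \<open>n\<close>-cell, so
\<open>class_energy F N K J n u\<close> is at most a constant times \<open>\<rho>^(2n)\<close> times the number \<open>T n\<close> of words
\<open>w\<close> of length \<open>n\<close> whose cell \<open>V\<^sub>w\<close> meets \<open>J\<close>.  Everything rests on the counting estimate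
\<open>class_cell_count\<close>: if the \<open>s\<close>-dimensional Hausdorff measure of \<open>closure J\<close> is finite, then
\<open>\<rho>^(s n) * T n\<close> is bounded.  When \<open>R \<le> \<rho> powr (- (2 - s))\<close> this bounds \<open>R^n * class_energy\<close>.
For the second claim take \<open>s = \<gamma>\<close>; for the first, the strict inequality leaves room for some
\<open>s \<ge> \<gamma>\<close>, arbitrarily close to \<open>\<gamma>\<close>, at which the measure is zero.

The counting estimate has three ingredients.

\<^item> Finitely many types.  The trace \<open>F\<^sub>w\<inverse>(J) \<inter> V\<^sub>0\<close> determines the whole of \<open>F\<^sub>w\<inverse>(J)\<close> inside
\<open>V\<^sub>*\<close>, because distinct cells meet only in boundary points (\<open>cell_overlap\<close>), so that a chain of
equivalences which leaves the cell has to leave it through its boundary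
(\<open>sim_boundary_factor\<close>).  Hence the trace at \<open>w @ [i]\<close> is a function of \<open>i\<close> and of the trace at
\<open>w\<close>, and the words counted by \<open>T n\<close> are those accepted by a finite automaton with state set
\<open>Pow V\<^sub>0\<close>.

\<^item> From covers to words.  A set of diameter comparable to \<open>\<rho>^n\<close> meets a bounded number of level-\<open>n\<close>
cells (\<open>bounded_overlap\<close>).  All maps are homotheties of the same ratio, so if two cells
of level \<open>n\<close> touch, then one is the translate of the other by \<open>\<rho>^n (a - a')\<close> with \<open>a, a' \<in> V\<^sub>0\<close>;
up to scaling there are finitely many such configurations, which gives both a bound
on the number of neighbours and a uniform gap between cells that do not touch.  Covers of
\<open>closure J\<close> with small sets and bounded \<open>s\<close>-sums therefore become finite sets of long words
which every sufficiently long accepted word extends, with bounded weighted size.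

\<^item> A fact about finite automata (\<open>weighted_count_bounded\<close>).  Give a word \<open>w\<close> the weight
\<open>x^|w|\<close>, where \<open>x = \<rho> powr s\<close>.  If cutsets of bounded total weight exist at arbitrarily
large depth, then \<open>x^n\<close> times the number of accepted words of length \<open>n\<close> is bounded.  States
of positive content (infimum of the weights of cutsets) cannot occur too often, since the
contents of all states of a level together stay bounded; from a state of zero content the
weighted numbers of accepted words are even summable over all lengths; and a word splits at the
first visit to a state of zero content, so the total is at most the convolution of a bounded
with a summable sequence.  This replaces a Perron-Frobenius analysis of the components of the
automaton.
\<close>

section \<open>Words and sums over words\<close>

lemma sum_UNION_le:
  fixes g :: "'b \<Rightarrow> real"
  assumes "finite I" "\<And>i. i \<in> I \<Longrightarrow> finite (A i)" "\<And>a. 0 \<le> g a"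
  shows "sum g (\<Union>i\<in>I. A i) \<le> (\<Sum>i\<in>I. sum g (A i))"
  using assms(1,2)
proof (induction I rule: finite_induct)
  case empty
  then show ?case by simp
next
  case (insert i I)
  have "sum g (\<Union>j\<in>insert i I. A j) = sum g (A i) + sum g (\<Union>j\<in>I. A j) - sum g (A i \<inter> (\<Union>j\<in>I. A j))"
    using insert by (simp add: sum_Un)
  also have "\<dots> \<le> sum g (A i) + sum g (\<Union>j\<in>I. A j)"
    using assms(3) by (simp add: sum_nonneg)
  finally show ?case using insert by auto
qed

lemma finite_words: "finite (words N n)"
proof -
  have "words N n = {w. set w \<subseteq> {1..N} \<and> length w = n}"
    by (auto simp: words_def)
  then show ?thesis
    by (simp add: finite_lists_length_eq)
qed

lemma words_0 [simp]: "words N 0 = {[]}"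
  by (auto simp: words_def)

lemma sum_words_Suc:
  "(\<Sum>w\<in>words N (Suc n). g w) = (\<Sum>i=1..N. \<Sum>w\<in>words N n. g (i # w))"
proof -
  have "words N (Suc n) = (\<lambda>(i, w). i # w) ` ({1..N} \<times> words N n)"
    by (auto simp: words_def length_Suc_conv image_iff)
  moreover have "inj_on (\<lambda>(i, w). i # w) ({1..N} \<times> words N n)"
    by (auto simp: inj_on_def)
  ultimately have "(\<Sum>w\<in>words N (Suc n). g w) = (\<Sum>(i, w)\<in>{1..N} \<times> words N n. g (i # w))"
    by (simp add: sum.reindex case_prod_unfold)
  then show ?thesis
    by (simp add: sum.cartesian_product)
qed

lemma words_set: "w \<in> words N n \<Longrightarrow> set w \<subseteq> {1..N}"
  by (simp add: words_def)

lemma take_words: "w \<in> words N n \<Longrightarrow> k \<le> n \<Longrightarrow> take k w \<in> words N k"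
  by (auto simp: words_def dest: in_set_takeD)

lemma drop_words: "w \<in> words N n \<Longrightarrow> drop k w \<in> words N (n - k)"
  by (auto simp: words_def dest: in_set_dropD)

lemma card_words: "card (words N n) = N ^ n"
proof -
  have "words N n = {w. set w \<subseteq> {1..N} \<and> length w = n}"
    by (auto simp: words_def)
  then show ?thesis
    by (simp add: card_lists_length_eq)
qed

section \<open>Weighted counting of the words accepted by a finite automaton\<close>

text \<open>
A deterministic automaton with input letters \<open>1..N\<close>, in which a dead state never becomes alive
again.  The weight \<open>x\<close> per letter plays the role of \<open>\<rho> powr s\<close>.
\<close>
locale weighted_automaton =
  fixes X :: "'b set" and N :: nat and \<Phi> :: "nat \<Rightarrow> 'b \<Rightarrow> 'b"
    and alive :: "'b \<Rightarrow> bool" and x :: real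
  assumes finite_states: "finite X"
    and step_closed: "\<And>i A. i \<in> {1..N} \<Longrightarrow> A \<in> X \<Longrightarrow> \<Phi> i A \<in> X"
    and dead_step: "\<And>i A. i \<in> {1..N} \<Longrightarrow> A \<in> X \<Longrightarrow> \<not> alive A \<Longrightarrow> \<not> alive (\<Phi> i A)"
    and x_pos: "0 < x"
begin

definition transfer :: "('b \<Rightarrow> real) \<Rightarrow> 'b \<Rightarrow> real" where
  "transfer g A = x * (\<Sum>i=1..N. g (\<Phi> i A))"

abbreviation live :: "'b \<Rightarrow> real" where
  "live A \<equiv> of_bool (alive A)"

text \<open>
The least weight of a cutset of depth at most \<open>d\<close> for the tree of accepted words, computed from
the root: either the empty word is in the cutset, at cost 1, or the subtrees are cut
separately.  It decreases to a finite-state analogue of Hausdorff content.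
\<close>

primrec content :: "nat \<Rightarrow> 'b \<Rightarrow> real" where
  "content 0 A = live A"
| "content (Suc d) A = min (live A) (transfer (content d) A)"

lemma transfer_mono:
  assumes "\<And>B. B \<in> X \<Longrightarrow> g B \<le> h B" and "A \<in> X"
  shows "transfer g A \<le> transfer h A"
  unfolding transfer_def using assms x_pos step_closed
  by (intro mult_left_mono sum_mono) auto

lemma transfer_nonneg:
  assumes "\<And>B. B \<in> X \<Longrightarrow> 0 \<le> g B" and "A \<in> X"
  shows "0 \<le> transfer g A"
  unfolding transfer_def using assms x_pos step_closed
  by (intro mult_nonneg_nonneg sum_nonneg) auto

lemma transfer_pow_mono:
  assumes "\<And>B. B \<in> X \<Longrightarrow> g B \<le> h B" and "A \<in> X"
  shows "(transfer ^^ n) g A \<le> (transfer ^^ n) h A"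
  using assms(2)
proof (induction n arbitrary: A)
  case 0
  then show ?case using assms(1) by simp
next
  case (Suc n)
  then show ?case by (auto intro: transfer_mono)
qed

lemma transfer_pow_nonneg:
  assumes "\<And>B. B \<in> X \<Longrightarrow> 0 \<le> g B" and "A \<in> X"
  shows "0 \<le> (transfer ^^ n) g A"
  using assms(2)
proof (induction n arbitrary: A)
  case 0
  then show ?case using assms(1) by simp
next
  case (Suc n)
  then show ?case by (auto intro: transfer_nonneg)
qed

lemma transfer_scale: "transfer (\<lambda>B. c * g B) A = c * transfer g A"
  by (simp add: transfer_def sum_distrib_left[symmetric])

lemma transfer_pow_scale: "(transfer ^^ n) (\<lambda>B. c * g B) A = c * (transfer ^^ n) g A"
proof (induction n arbitrary: A)
  case 0
  then show ?case by simp
next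
  case (Suc n)
  then have "(transfer ^^ n) (\<lambda>B. c * g B) = (\<lambda>B. c * (transfer ^^ n) g B)"
    by blast
  then show ?case by (simp add: transfer_scale)
qed

lemma transfer_sum: "transfer (\<lambda>B. \<Sum>k\<in>I. g k B) A = (\<Sum>k\<in>I. transfer (g k) A)"
  unfolding transfer_def by (subst sum.swap) (simp add: sum_distrib_left)

lemma transfer_pow_words:
  "(transfer ^^ n) g A = x ^ n * (\<Sum>w\<in>words N n. g (fold \<Phi> w A))"
proof (induction n arbitrary: A)
  case 0
  then show ?case by simp
next
  case (Suc n)
  then show ?case
    by (simp add: transfer_def sum_words_Suc sum_distrib_left mult.assoc)
qed

lemma content_nonneg: "A \<in> X \<Longrightarrow> 0 \<le> content d A"
  by (induction d arbitrary: A) (auto intro: transfer_nonneg)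

lemma content_le_live: "content d A \<le> live A"
  by (cases d) auto

lemma content_Suc_le: "A \<in> X \<Longrightarrow> content (Suc d) A \<le> content d A"
proof (induction d arbitrary: A)
  case 0
  then show ?case by simp
next
  case (Suc d)
  have "transfer (content (Suc d)) A \<le> transfer (content d) A"
    using Suc by (intro transfer_mono) auto
  then show ?case by simp
qed

lemma content_antimono: "A \<in> X \<Longrightarrow> d \<le> e \<Longrightarrow> content e A \<le> content d A"
  by (rule lift_Suc_antimono_le[of "\<lambda>d. content d A"]) (rule content_Suc_le)

text \<open>
Iterating the transfer operator \<open>m\<close> times makes the first \<open>m\<close> letters obligatory, so this
quantity is the least weight of a cutset whose words have length between \<open>m\<close> and \<open>m + d\<close>.  The
induction strips the first letter from all words, and stops at the empty word.
\<close>
lemma transfer_content_le_cutset: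
  assumes "finite W" and "\<And>w. w \<in> W \<Longrightarrow> m \<le> length w"
    and "\<And>v. v \<in> words N (m + d) \<Longrightarrow> alive (fold \<Phi> v A) \<Longrightarrow> \<exists>k. take k v \<in> W"
    and "A \<in> X"
  shows "(transfer ^^ m) (content d) A \<le> (\<Sum>w\<in>W. x ^ length w)"
  using assms
proof (induction "m + d" arbitrary: m d W A)
  case 0
  have "1 \<le> (\<Sum>w\<in>W. x ^ length w)" if "alive A"
  proof -
    have "[] \<in> W" using 0 that by auto
    then show ?thesis
      using sum_mono2[of W "{[]}" "\<lambda>w. x ^ length w"] \<open>finite W\<close> x_pos by auto
  qed
  then show ?case using 0 x_pos by (auto intro: sum_nonneg)
next
  case (Suc n)
  define W' where "W' = (\<lambda>i. {v. i # v \<in> W})"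
  have fin': "finite (W' i)" for i
    unfolding W'_def using finite_vimageI[OF \<open>finite W\<close>, of "Cons i"] by (simp add: vimage_def)
  have step: "(\<Sum>i=1..N. x * (\<Sum>v\<in>W' i. x ^ length v)) \<le> (\<Sum>w\<in>W. x ^ length w)"
  proof -
    have "(\<Sum>i=1..N. x * (\<Sum>v\<in>W' i. x ^ length v))
        = (\<Sum>(i, v)\<in>Sigma {1..N} W'. x ^ length (i # v))"
      using fin' by (simp add: sum.Sigma[symmetric] sum_distrib_left)
    also have "\<dots> = (\<Sum>w\<in>(\<lambda>(i, v). i # v) ` Sigma {1..N} W'. x ^ length w)"
      by (subst sum.reindex) (auto simp: inj_on_def case_prod_unfold)
    also have "\<dots> \<le> (\<Sum>w\<in>W. x ^ length w)"
      using \<open>finite W\<close> x_pos by (intro sum_mono2) (auto simp: W'_def)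
    finally show ?thesis .
  qed
  have cover': "\<exists>k. take k v \<in> W' i"
    if v: "v \<in> words N n" "i \<in> {1..N}" "alive (fold \<Phi> v (\<Phi> i A))" and "[] \<notin> W" for v i
  proof -
    have "i # v \<in> words N (m + d)"
      using v Suc(2) by (auto simp: words_def)
    then obtain k where k: "take k (i # v) \<in> W"
      using Suc(5)[of "i # v"] v by auto
    then obtain k' where "k = Suc k'"
      using \<open>[] \<notin> W\<close> by (cases k) auto
    then show ?thesis using k by (auto simp: W'_def)
  qed
  show ?case
  proof (cases "[] \<in> W")
    case True
    then have "m = 0" using Suc(4) by fastforce
    have "content d A \<le> 1" using content_le_live[of d A] by (auto split: if_splits simp: of_bool_def)
    also have "1 \<le> (\<Sum>w\<in>W. x ^ length w)"
      using sum_mono2[of W "{[]}" "\<lambda>w. x ^ length w"] \<open>finite W\<close> x_pos True by auto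
    finally show ?thesis by (simp add: \<open>m = 0\<close>)
  next
    case False
    have *: "(transfer ^^ m') (content d') (\<Phi> i A) \<le> (\<Sum>v\<in>W' i. x ^ length v)"
      if "i \<in> {1..N}" "n = m' + d'" "m' \<le> m - 1" for i m' d'
    proof (rule Suc(1))
      show "m' \<le> length v" if "v \<in> W' i" for v
        using Suc(4)[of "i # v"] that \<open>m' \<le> m - 1\<close> by (auto simp: W'_def)
      show "n = m' + d'" by fact
      show "finite (W' i)" by (rule fin')
      show "\<Phi> i A \<in> X" using step_closed that(1) Suc.prems(4) by blast
      show "\<exists>k. take k v \<in> W' i" if "v \<in> words N (m' + d')" "alive (fold \<Phi> v (\<Phi> i A))" for v
        using cover'[of v i] that \<open>n = m' + d'\<close> \<open>i \<in> {1..N}\<close> False by blast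
    qed
    have **: "transfer ((transfer ^^ m') (content d')) A \<le> (\<Sum>w\<in>W. x ^ length w)"
      if "n = m' + d'" "m' \<le> m - 1" for m' d'
    proof -
      have "transfer ((transfer ^^ m') (content d')) A
          = (\<Sum>i=1..N. x * (transfer ^^ m') (content d') (\<Phi> i A))"
        by (simp add: transfer_def sum_distrib_left)
      also have "\<dots> \<le> (\<Sum>i=1..N. x * (\<Sum>v\<in>W' i. x ^ length v))"
        using *[OF _ that] x_pos by (intro sum_mono mult_left_mono) auto
      finally show ?thesis using step by linarith
    qed
    show ?thesis
    proof (cases m)
      case 0
      then obtain d' where "d = Suc d'" using Suc(2) by (cases d) auto
      then show ?thesis
        using **[of 0 d'] 0 Suc(2) by (auto intro: order_trans[OF min.cobounded2])
    next
      case (Suc m')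
      then show ?thesis using **[of m' d] \<open>Suc n = m + d\<close> by auto
    qed
  qed
qed

definition null :: "'b set" where
  "null = {A \<in> X. \<forall>\<epsilon>>0. \<exists>d. content d A < \<epsilon>}"

lemma null_step:
  assumes "A \<in> null" and i: "i \<in> {1..N}"
  shows "\<Phi> i A \<in> null"
proof -
  have A: "A \<in> X" and small: "\<And>\<epsilon>. \<epsilon> > 0 \<Longrightarrow> \<exists>d. content d A < \<epsilon>"
    using assms by (auto simp: null_def)
  have mem: "\<Phi> i A \<in> X" using step_closed A i by blast
  have "\<exists>d. content d (\<Phi> i A) < \<epsilon>" if \<epsilon>: "\<epsilon> > 0" for \<epsilon>
  proof (cases "alive A")
    case False
    then have "content 0 (\<Phi> i A) < \<epsilon>" using dead_step A i that by simp
    then show ?thesis by blast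
  next
    case True
    obtain d where d: "content d A < min 1 (x * \<epsilon>)"
      using small[of "min 1 (x * \<epsilon>)"] \<epsilon> x_pos by (metis min_less_iff_conj mult_pos_pos zero_less_one)
    then obtain e where e: "d = Suc e" using True by (cases d) auto
    then have "transfer (content e) A < x * \<epsilon>" using d True by auto
    moreover have "x * content e (\<Phi> i A) \<le> transfer (content e) A"
      unfolding transfer_def using x_pos i content_nonneg step_closed A
      by (intro mult_left_mono member_le_sum) auto
    ultimately have "x * content e (\<Phi> i A) < x * \<epsilon>" by linarith
    then show ?thesis using x_pos by auto
  qed
  then show ?thesis using mem by (auto simp: null_def)
qed

text \<open>
Once \<open>D\<close> is so large that all null states have \<open>content D \<le> 1/2\<close>, unfolding the sum \<open>S\<close> of the
weighted counts along an optimal cutset expresses it through the same sums at the words of the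
cutset.  These are at most the maximum \<open>\<sigma>\<close> of \<open>S\<close>, and they enter with total weight at most
\<open>1/2\<close>; the levels above the cutset contribute a constant \<open>Q D\<close>.  Thus \<open>\<sigma> \<le> Q D + \<sigma> / 2\<close>.
\<close>
lemma null_sums_bounded:
  obtains B where "\<And>A n. A \<in> null \<Longrightarrow> (\<Sum>k<n. (transfer ^^ k) live A) \<le> B"
proof -
  have fin: "finite null" using finite_states by (auto simp: null_def)
  have sub: "null \<subseteq> X" by (auto simp: null_def)
  define S where "S = (\<lambda>n A. \<Sum>k<n. (transfer ^^ k) live A)"
  have S_nonneg: "0 \<le> S n A" if "A \<in> X" for n A
    unfolding S_def using that by (intro sum_nonneg transfer_pow_nonneg) auto
  have S_dead: "S n A = 0" if "A \<in> X" "\<not> alive A" for n A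
  proof -
    have "(transfer ^^ k) live A = 0" for k
      using that by (induction k arbitrary: A) (auto simp: transfer_def step_closed dead_step)
    then show ?thesis by (simp add: S_def)
  qed
  have S_step: "S n A \<le> 1 + transfer (S n) A" if "A \<in> X" for n A
  proof -
    have "S n A \<le> S (Suc n) A"
      unfolding S_def using that by (auto intro!: transfer_pow_nonneg)
    also have "\<dots> = live A + transfer (S n) A"
      unfolding S_def by (subst sum.lessThan_Suc_shift) (simp add: transfer_sum)
    finally show ?thesis by (auto simp: of_bool_def split: if_splits)
  qed
  have "\<exists>d. content d A < 1/2" if "A \<in> null" for A
    using that half_gt_zero[OF zero_less_one] unfolding null_def by blast
  then obtain d where d: "\<And>A. A \<in> null \<Longrightarrow> content (d A) A < 1/2" by metis
  define D where "D = (\<Sum>A\<in>null. d A)"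
  have D: "content D A \<le> 1/2" if "A \<in> null" for A
  proof -
    have "d A \<le> D" unfolding D_def using fin that by (intro member_le_sum) auto
    then show ?thesis using content_antimono[of A "d A" D] d[OF that] that sub by fastforce
  qed
  (* The cost of the levels above a cutset of depth e: one for the root, plus the
     contributions of its N subtrees. *)
  define Q where "Q = rec_nat (0::real) (\<lambda>_ q. 1 + x * real N * q)"
  have Q: "Q 0 = 0" "Q (Suc e) = 1 + x * real N * Q e" for e by (simp_all add: Q_def)
  have Q_nonneg: "0 \<le> Q e" for e using x_pos by (induction e) (auto simp: Q)
  have main: "S n A \<le> Q e + content e A * \<sigma>"
    if "A \<in> null" and \<sigma>: "\<And>B. B \<in> null \<Longrightarrow> S n B \<le> \<sigma>" for n A e \<sigma>
    using \<open>A \<in> null\<close>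
  proof (induction e arbitrary: A)
    case 0
    then show ?case using \<sigma>[of A] S_dead[of A n] sub by (auto simp: Q)
  next
    case (Suc e)
    have A: "A \<in> X" using Suc sub by auto
    have "content (Suc e) A = 1 \<or> content (Suc e) A = transfer (content e) A" if "alive A"
      using that by (simp add: min_def)
    then consider (dead) "\<not> alive A" | (stop) "content (Suc e) A = 1"
      | (go) "content (Suc e) A = transfer (content e) A"
      by blast
    then show ?case
    proof cases
      case dead
      then have "0 \<le> content (Suc e) A" "content (Suc e) A \<le> 0"
        using content_nonneg[OF A, of "Suc e"] content_le_live[of "Suc e" A] by (simp_all del: content.simps)
      then show ?thesis using S_dead[OF A dead, of n] Q_nonneg[of "Suc e"] by (simp del: content.simps)
    next
      case stop
      then show ?thesis using \<sigma>[OF Suc.prems] Q_nonneg[of "Suc e"] by (simp del: content.simps)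
    next
      case go
      have "S n A \<le> 1 + transfer (S n) A" by (rule S_step[OF A])
      also have "transfer (S n) A \<le> x * (\<Sum>i=1..N. Q e + content e (\<Phi> i A) * \<sigma>)"
        unfolding transfer_def using Suc null_step x_pos by (intro mult_left_mono sum_mono) auto
      also have "1 + x * (\<Sum>i=1..N. Q e + content e (\<Phi> i A) * \<sigma>)
          = Q (Suc e) + transfer (content e) A * \<sigma>"
        by (simp add: Q transfer_def sum.distrib sum_distrib_right sum_distrib_left algebra_simps)
      finally show ?thesis using go by (simp del: content.simps)
    qed
  qed
  have "S n A \<le> 2 * Q D" if "A \<in> null" for n A
  proof -
    define \<sigma> where "\<sigma> = Max (S n ` null)"
    have ne: "S n ` null \<noteq> {}" "finite (S n ` null)" using that fin by auto
    have le: "S n B \<le> \<sigma>" if "B \<in> null" for B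
      unfolding \<sigma>_def using ne that by (intro Max_ge) auto
    obtain B where B: "B \<in> null" "S n B = \<sigma>"
      using Max_in[OF ne(2,1)] unfolding \<sigma>_def by auto
    have "0 \<le> \<sigma>" using S_nonneg[of B n] B sub by auto
    then have "content D B * \<sigma> \<le> 1/2 * \<sigma>" using D[OF B(1)] by (intro mult_right_mono)
    then have "\<sigma> \<le> 2 * Q D" using main[OF B(1) le, of D] B(2) by linarith
    then show ?thesis using le[OF that] by linarith
  qed
  then show ?thesis using that unfolding S_def by blast
qed

text \<open>
Here \<open>a n\<close> counts the words ending in a state of positive content; it is bounded because such
states have content at least a common \<open>\<epsilon>\<close>, while the hypothesis bounds the total content of
each level.  The remaining words are split at their first null state, which gives the
convolution in \<open>decomp\<close> with the summable sequence \<open>\<tau>\<close> of counts from null states.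
\<close>
proposition weighted_count_bounded:
  assumes A0: "A0 \<in> X" and C: "\<And>m. \<exists>d. (transfer ^^ m) (content d) A0 \<le> C"
  obtains B where "\<And>n. (transfer ^^ n) live A0 \<le> B"
proof -
  have fin: "finite null" using finite_states by (auto simp: null_def)
  have sub: "null \<subseteq> X" by (auto simp: null_def)
  define pos where "pos = (\<lambda>A. of_bool (A \<notin> null) :: real)"
  define a where "a = (\<lambda>n. (transfer ^^ n) pos)"
  define t where "t = (\<lambda>n. (transfer ^^ n) live)"
  define \<tau> where "\<tau> = (\<lambda>n. \<Sum>A\<in>null. t n A)"
  have t_nonneg: "0 \<le> t n A" if "A \<in> X" for n A
    unfolding t_def using that by (intro transfer_pow_nonneg) auto
  have a_nonneg: "0 \<le> a n A" if "A \<in> X" for n A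
    unfolding a_def using that by (intro transfer_pow_nonneg) (auto simp: pos_def)
  have \<tau>_nonneg: "0 \<le> \<tau> n" for n unfolding \<tau>_def using t_nonneg sub by (intro sum_nonneg) auto
  have t_le_\<tau>: "t n A \<le> \<tau> n" if "A \<in> null" for n A
    unfolding \<tau>_def using that fin sub t_nonneg by (intro member_le_sum) auto
  have a_Suc: "a (Suc n) A = x * (\<Sum>i=1..N. a n (\<Phi> i A))" for n A
    by (simp add: a_def transfer_def)
  have t_Suc: "t (Suc n) A = x * (\<Sum>i=1..N. t n (\<Phi> i A))" for n A
    by (simp add: t_def transfer_def)

  have "\<forall>A\<in>X - null. \<exists>\<epsilon>>0. \<forall>d. \<epsilon> \<le> content d A"
    unfolding null_def by (auto simp: not_less)
  then obtain e where e: "\<And>A. A \<in> X - null \<Longrightarrow> 0 < e A \<and> (\<forall>d. e A \<le> content d A)"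
    by metis
  define \<epsilon> where "\<epsilon> = Min (insert 1 (e ` (X - null)))"
  have \<epsilon>: "0 < \<epsilon>" unfolding \<epsilon>_def using finite_states e by (subst Min_gr_iff) auto
  have \<epsilon>_le: "\<epsilon> * pos A \<le> content d A" if "A \<in> X" for A d
  proof (cases "A \<in> null")
    case True
    then show ?thesis using content_nonneg[OF that] by (simp add: pos_def)
  next
    case False
    then have "\<epsilon> \<le> e A" unfolding \<epsilon>_def using finite_states that by (intro Min_le) auto
    then show ?thesis using e[of A] False that by (auto simp: pos_def intro: order_trans)
  qed
  have a_bound: "a n A0 \<le> C / \<epsilon>" for n
  proof -
    obtain d where "(transfer ^^ n) (content d) A0 \<le> C" using C by blast
    moreover have "\<epsilon> * a n A0 \<le> (transfer ^^ n) (content d) A0"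
      unfolding a_def using transfer_pow_mono[where n = n, OF \<epsilon>_le[where d = d] A0]
      by (simp add: transfer_pow_scale)
    ultimately show ?thesis using \<epsilon> by (simp add: field_simps)
  qed
  have C_nonneg: "0 \<le> C / \<epsilon>" using a_bound[of 0] a_nonneg[OF A0, of 0] by linarith

  have decomp: "t n A \<le> a n A + \<tau> n * of_bool (A \<in> null) + x * real N * (\<Sum>j<n. a j A * \<tau> (n - Suc j))"
    if "A \<in> X" for n A
    using that
  proof (induction n arbitrary: A)
    case 0
    then show ?case using t_le_\<tau>[of A 0] by (auto simp: t_def a_def pos_def)
  next
    case (Suc n)
    have rest: "0 \<le> x * real N * (\<Sum>j<Suc n. a j A * \<tau> (Suc n - Suc j))"
      using x_pos a_nonneg[OF Suc.prems] \<tau>_nonneg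
      by (intro mult_nonneg_nonneg sum_nonneg) auto
    show ?case
    proof (cases "A \<in> null")
      case True
      then show ?thesis using t_le_\<tau>[OF True, of "Suc n"] rest a_nonneg[OF Suc.prems, of "Suc n"] by simp
    next
      case False
      have "t (Suc n) A \<le> x * (\<Sum>i=1..N. a n (\<Phi> i A) + \<tau> n
          + x * real N * (\<Sum>j<n. a j (\<Phi> i A) * \<tau> (n - Suc j)))"
        unfolding t_Suc
      proof (intro mult_left_mono sum_mono)
        fix i assume "i \<in> {1..N}"
        then have "t n (\<Phi> i A) \<le> a n (\<Phi> i A) + \<tau> n * of_bool (\<Phi> i A \<in> null)
          + x * real N * (\<Sum>j<n. a j (\<Phi> i A) * \<tau> (n - Suc j))"
          using Suc step_closed by blast
        moreover have "\<tau> n * of_bool (\<Phi> i A \<in> null) \<le> \<tau> n" using \<tau>_nonneg[of n] by simp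
        ultimately show "t n (\<Phi> i A) \<le> a n (\<Phi> i A) + \<tau> n
          + x * real N * (\<Sum>j<n. a j (\<Phi> i A) * \<tau> (n - Suc j))" by linarith
      qed (use x_pos in auto)
      also have "\<dots> = a (Suc n) A + x * real N * \<tau> n
          + x * real N * (x * (\<Sum>i=1..N. \<Sum>j<n. a j (\<Phi> i A) * \<tau> (n - Suc j)))"
        by (simp add: a_Suc sum.distrib sum_distrib_left algebra_simps)
      also have "x * (\<Sum>i=1..N. \<Sum>j<n. a j (\<Phi> i A) * \<tau> (n - Suc j))
          = (\<Sum>j<n. a (Suc j) A * \<tau> (n - Suc j))"
        by (subst sum.swap) (simp add: a_Suc sum_distrib_left sum_distrib_right mult.assoc)
      also have "a (Suc n) A + x * real N * \<tau> n + x * real N * (\<Sum>j<n. a (Suc j) A * \<tau> (n - Suc j))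
          = a (Suc n) A + x * real N * (\<Sum>j<Suc n. a j A * \<tau> (Suc n - Suc j))"
        using False by (subst sum.lessThan_Suc_shift) (simp add: a_def pos_def algebra_simps)
      finally show ?thesis using False by simp
    qed
  qed

  obtain B where B: "\<And>A n. A \<in> null \<Longrightarrow> (\<Sum>k<n. t k A) \<le> B"
    using null_sums_bounded unfolding t_def by blast
  have \<tau>_sum: "(\<Sum>k<n. \<tau> k) \<le> real (card null) * B" for n
  proof -
    have "(\<Sum>k<n. \<tau> k) = (\<Sum>A\<in>null. \<Sum>k<n. t k A)" unfolding \<tau>_def by (rule sum.swap)
    also have "\<dots> \<le> (\<Sum>A\<in>null. B)" by (intro sum_mono B)
    finally show ?thesis by simp
  qed
  define B' where "B' = real (card null) * B"
  have "t n A0 \<le> C / \<epsilon> + B' + x * real N * (C / \<epsilon> * B')" for n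
  proof -
    have "\<tau> n * of_bool (A0 \<in> null) \<le> \<tau> n" using \<tau>_nonneg[of n] by simp
    also have "\<dots> \<le> (\<Sum>k<Suc n. \<tau> k)" using \<tau>_nonneg by (intro member_le_sum) auto
    also have "\<dots> \<le> B'" using \<tau>_sum unfolding B'_def by blast
    finally have 1: "\<tau> n * of_bool (A0 \<in> null) \<le> B'" .
    have "(\<Sum>j<n. a j A0 * \<tau> (n - Suc j)) \<le> (\<Sum>j<n. C / \<epsilon> * \<tau> (n - Suc j))"
      using a_bound \<tau>_nonneg by (intro sum_mono mult_right_mono)
    also have "\<dots> = C / \<epsilon> * (\<Sum>j<n. \<tau> j)"
      by (simp only: sum_distrib_left[symmetric] sum.nat_diff_reindex)
    also have "\<dots> \<le> C / \<epsilon> * B'" using \<tau>_sum C_nonneg unfolding B'_def by (intro mult_left_mono)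
    finally have 2: "x * real N * (\<Sum>j<n. a j A0 * \<tau> (n - Suc j)) \<le> x * real N * (C / \<epsilon> * B')"
      using x_pos by (intro mult_left_mono) auto
    show ?thesis using decomp[OF A0, of n] a_bound[of n] 1 2 by linarith
  qed
  then show ?thesis using that unfolding t_def by blast
qed

end

section \<open>Finite covers from finite Hausdorff measure\<close>

text \<open>
A set of small diameter is assigned the finest scale \<open>\<rho>^k\<close> that still exceeds its diameter; then
\<open>\<rho>^(k+1) \<le> diameter U\<close>, which compares the weights.  There is no finest scale if the diameter is
zero: for \<open>s > 0\<close> the scale is then taken so fine that its weight is below \<open>\<eta>\<close>, and for
\<open>s = 0\<close> every scale has weight \<open>1 = diam_powr 0 U\<close>.
\<close>
lemma diameter_scale_choice:
  fixes U :: "'a::metric_space set"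
  assumes \<rho>: "0 < \<rho>" "\<rho> < 1" and s: "0 \<le> s" and \<eta>: "0 < \<eta>"
    and U: "bounded U" "U \<noteq> {}" "diameter U \<le> \<rho> ^ Suc m"
  obtains k where "m \<le> k" and "diameter U < \<rho> ^ k"
    and "ennreal ((\<rho> powr s) ^ k) \<le> ennreal (1 / \<rho> powr s) * diam_powr s U + ennreal \<eta>"
proof -
  define d where "d = diameter U"
  have d: "0 \<le> d" "d \<le> \<rho> ^ Suc m" using U diameter_ge_0 by (auto simp: d_def)
  have pow_Suc: "\<rho> ^ Suc n < \<rho> ^ n" for n using \<rho> by (simp add: power_strict_decreasing)
  have tends: "(\<lambda>n. \<rho> ^ n) \<longlonglongrightarrow> 0" using \<rho> by (intro LIMSEQ_power_zero) auto
  consider "s = 0" | "s > 0" "d = 0" | "s > 0" "d > 0" using s d by linarith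
  then show ?thesis
  proof cases
    case 1
    have "d < \<rho> ^ m" using d pow_Suc[of m] by linarith
    then show ?thesis using that[of m] 1 U(2) \<rho> by (simp add: diam_powr_def d_def)
  next
    case 2
    have "\<rho> powr s < 1" using \<rho> 2 powr_less_mono2[of s \<rho> 1] by simp
    then have "(\<lambda>n. (\<rho> powr s) ^ n) \<longlonglongrightarrow> 0" using \<rho> by (intro LIMSEQ_power_zero) auto
    then have "eventually (\<lambda>n. (\<rho> powr s) ^ n < \<eta>) sequentially"
      using \<eta> by (rule order_tendstoD)
    then obtain k where k: "m \<le> k" "(\<rho> powr s) ^ k < \<eta>"
      using eventually_sequentially by (metis nat_le_linear)
    have "ennreal ((\<rho> powr s) ^ k) \<le> ennreal \<eta>" using k(2) by (intro ennreal_leI) simp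
    then show ?thesis using that[of k] k 2 \<rho> by (simp add: d_def add_increasing)
  next
    case 3
    have "eventually (\<lambda>n. \<rho> ^ n < d) sequentially" using tends 3(2) by (rule order_tendstoD)
    then obtain j0 where j0: "\<rho> ^ j0 \<le> d"
      unfolding eventually_sequentially by (meson le_refl less_imp_le)
    define j where "j = (LEAST j. \<rho> ^ j \<le> d)"
    have j: "\<rho> ^ j \<le> d" unfolding j_def using j0 by (rule LeastI)
    have "Suc m \<le> j"
    proof (rule ccontr)
      assume "\<not> Suc m \<le> j"
      then have "\<rho> ^ Suc m < \<rho> ^ j" using \<rho> by (intro power_strict_decreasing) auto
      then show False using j d by linarith
    qed
    then obtain k where k: "j = Suc k" "m \<le> k" by (cases j) auto
    have "\<not> \<rho> ^ k \<le> d" using not_less_Least[of k "\<lambda>j. \<rho> ^ j \<le> d"] k(1) j_def by simp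
    then have less: "d < \<rho> ^ k" by simp
    have "(\<rho> powr s) ^ Suc k = (\<rho> ^ Suc k) powr s"
      using \<rho> by (simp add: powr_power powr_powr powr_realpow[symmetric] mult.commute del: power_Suc of_nat_Suc)
    also have "\<dots> \<le> d powr s" using j k(1) s \<rho> by (intro powr_mono2) auto
    finally have "(\<rho> powr s) ^ k \<le> 1 / \<rho> powr s * d powr s"
      using \<rho> by (simp add: field_simps)
    then have "ennreal ((\<rho> powr s) ^ k) \<le> ennreal (1 / \<rho> powr s * d powr s)"
      by (rule ennreal_leI)
    also have "\<dots> = ennreal (1 / \<rho> powr s) * diam_powr s U"
      using 3 U(2) by (simp add: diam_powr_def d_def ennreal_mult' [symmetric])
    finally show ?thesis using that[of k] k less by (simp add: d_def add_increasing2)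
  qed
qed

text \<open>
A near-optimal countable cover is thickened to an open one, each set by the scale assigned to
it, so that compactness leaves finitely many sets.  Thickening at most triples the scale, and the
errors \<open>\<eta> = (1/2)^i\<close> add up to at most 2, so the bound does not depend on \<open>n0\<close>.
\<close>
proposition finite_hausdorff_cover:
  fixes A :: "'a::metric_space set"
  assumes \<rho>: "0 < \<rho>" "\<rho> < 1" and s: "0 \<le> s"
    and A: "compact A" and fin: "hausdorff_measure s A < \<infinity>"
  obtains C where "\<And>n0. \<exists>(I :: nat set) U k. finite I \<and> A \<subseteq> (\<Union>i\<in>I. U i) \<and>
      (\<forall>i\<in>I. n0 \<le> k i \<and> (\<forall>y\<in>U i. \<forall>z\<in>U i. dist y z \<le> 3 * \<rho> ^ k i)) \<and>
      (\<Sum>i\<in>I. (\<rho> powr s) ^ k i) \<le> C"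
proof -
  define h where "h = hausdorff_measure s A"
  define C where "C = ennreal (1 / \<rho> powr s) * (h + 1) + 2"
  have "h \<noteq> top" using fin by (simp add: h_def infinity_ennreal_def)
  then have "ennreal (1 / \<rho> powr s) * (h + 1) \<noteq> top"
    by (subst ennreal_mult_eq_top_iff) auto
  then have C_fin: "C < top"
    unfolding C_def by (simp add: less_top[symmetric])
  have "\<exists>(I :: nat set) U k. finite I \<and> A \<subseteq> (\<Union>i\<in>I. U i) \<and>
      (\<forall>i\<in>I. n0 \<le> k i \<and> (\<forall>y\<in>U i. \<forall>z\<in>U i. dist y z \<le> 3 * \<rho> ^ k i)) \<and>
      (\<Sum>i\<in>I. (\<rho> powr s) ^ k i) \<le> enn2real C" for n0
  proof -
    have "hausdorff_premeasure s (\<rho> ^ Suc n0) A \<le> h"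
      unfolding h_def hausdorff_measure_def using \<rho> by (intro SUP_upper) auto
    also have "h < h + 1"
      using \<open>h \<noteq> top\<close>
      by (cases h) (auto simp: ennreal_less_iff simp flip: ennreal_1 ennreal_plus)
    finally obtain U :: "nat \<Rightarrow> 'a set" where U: "A \<subseteq> (\<Union>i. U i)" "\<And>i. bounded (U i)" "\<And>i. diameter (U i) \<le> \<rho> ^ Suc n0"
        and sum: "(\<Sum>i. diam_powr s (U i)) < h + 1"
      unfolding hausdorff_premeasure_def INF_less_iff by blast
    have "\<exists>k. U i \<noteq> {} \<longrightarrow> n0 \<le> k \<and> diameter (U i) < \<rho> ^ k \<and>
        ennreal ((\<rho> powr s) ^ k) \<le> ennreal (1 / \<rho> powr s) * diam_powr s (U i) + ennreal ((1/2) ^ i)" for i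
    proof (cases "U i = {}")
      case False
      show ?thesis
        by (rule diameter_scale_choice[OF \<rho> s, where \<eta> = "(1/2)^i" and U = "U i" and m = n0])
           (use False U in auto)
    qed auto
    then obtain k where k: "\<And>i. U i \<noteq> {} \<Longrightarrow> n0 \<le> k i" "\<And>i. U i \<noteq> {} \<Longrightarrow> diameter (U i) < \<rho> ^ k i"
      "\<And>i. U i \<noteq> {} \<Longrightarrow> ennreal ((\<rho> powr s) ^ k i)
          \<le> ennreal (1 / \<rho> powr s) * diam_powr s (U i) + ennreal ((1/2) ^ i)"
      by metis
    define G where "G = (\<lambda>i. \<Union>y\<in>U i. ball y (\<rho> ^ k i))"
    have cover: "A \<subseteq> (\<Union>i\<in>{i. U i \<noteq> {}}. G i)"
    proof
      fix y assume "y \<in> A"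
      then obtain i where "y \<in> U i" using U by blast
      then show "y \<in> (\<Union>i\<in>{i. U i \<noteq> {}}. G i)" using \<rho> by (auto simp: G_def intro!: exI[of _ i] bexI[of _ y])
    qed
    obtain I where I: "I \<subseteq> {i. U i \<noteq> {}}" "finite I" "A \<subseteq> (\<Union>i\<in>I. G i)"
    proof (rule compactE_image[OF A _ cover])
      show "open (G i)" for i unfolding G_def by blast
    qed
    have G_dist: "dist y z \<le> 3 * \<rho> ^ k i" if "i \<in> I" "y \<in> G i" "z \<in> G i" for i y z
    proof -
      obtain y' z' where yz: "y' \<in> U i" "dist y' y < \<rho> ^ k i" "z' \<in> U i" "dist z' z < \<rho> ^ k i"
        using \<open>y \<in> G i\<close> \<open>z \<in> G i\<close> unfolding G_def by auto
      have "dist y' z' \<le> diameter (U i)" using U(2) yz by (intro diameter_bounded_bound)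
      then have "dist y' z' \<le> \<rho> ^ k i" using k(2)[of i] yz by force
      moreover have "dist y z \<le> dist y' y + dist y' z' + dist z' z"
        using dist_triangle[of y z y'] dist_triangle[of y' z z'] by (simp add: dist_commute)
      ultimately show ?thesis using yz by linarith
    qed
    have "ennreal (\<Sum>i\<in>I. (\<rho> powr s) ^ k i) = (\<Sum>i\<in>I. ennreal ((\<rho> powr s) ^ k i))"
      by (subst sum_ennreal) auto
    also have "\<dots> \<le> (\<Sum>i\<in>I. ennreal (1 / \<rho> powr s) * diam_powr s (U i) + ennreal ((1/2) ^ i))"
    proof (rule sum_mono)
      fix i assume "i \<in> I"
      then show "ennreal ((\<rho> powr s) ^ k i)
          \<le> ennreal (1 / \<rho> powr s) * diam_powr s (U i) + ennreal ((1/2) ^ i)"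
        using k(3) I(1) by blast
    qed
    also have "\<dots> = ennreal (1 / \<rho> powr s) * (\<Sum>i\<in>I. diam_powr s (U i)) + (\<Sum>i\<in>I. ennreal ((1/2) ^ i))"
      by (simp add: sum.distrib sum_distrib_left)
    also have "\<dots> \<le> C"
      unfolding C_def
    proof (intro add_mono mult_left_mono)
      have "(\<Sum>i\<in>I. diam_powr s (U i)) \<le> (\<Sum>i. diam_powr s (U i))"
        using I(2) by (intro sum_le_suminf) auto
      then show "(\<Sum>i\<in>I. diam_powr s (U i)) \<le> h + 1" using sum by order
      have "(\<Sum>i\<in>I. (1/2) ^ i) \<le> (\<Sum>i. (1/2::real) ^ i)"
        using I(2) by (intro sum_le_suminf) (auto intro: summable_geometric)
      also have "\<dots> = 2" by (subst suminf_geometric) auto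
      finally have "ennreal (\<Sum>i\<in>I. (1/2) ^ i) \<le> ennreal 2" by (rule ennreal_leI)
      then show "(\<Sum>i\<in>I. ennreal ((1/2) ^ i)) \<le> 2" by (subst sum_ennreal) auto
    qed auto
    finally have "enn2real (ennreal (\<Sum>i\<in>I. (\<rho> powr s) ^ k i)) \<le> enn2real C"
      using C_fin by (intro enn2real_mono)
    then have "(\<Sum>i\<in>I. (\<rho> powr s) ^ k i) \<le> enn2real C" by (simp add: sum_nonneg)
    then show ?thesis using I k(1) G_dist
      by (intro exI[of _ I] exI[of _ G] exI[of _ k]) auto
  qed
  then show ?thesis using that by blast
qed

section \<open>Coding of the self-similar set\<close>

lemma word_map_Nil [simp]: "word_map F [] = id"
  by (simp add: word_map_def)

lemma word_map_Cons [simp]: "word_map F (i # w) = F i \<circ> word_map F w"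
  by (simp add: word_map_def)

lemma word_map_append: "word_map F (v @ w) = word_map F v \<circ> word_map F w"
  by (induction v) auto

text \<open>
Prefixing an infinite word by a finite one: the inverse branches of the powers of \<open>shift\<close>.
\<close>

definition prepend :: "nat list \<Rightarrow> (nat \<Rightarrow> nat) \<Rightarrow> nat \<Rightarrow> nat" where
  "prepend w \<xi> = foldr case_nat w \<xi>"

lemma shift_case_nat [simp]: "shift (case_nat i \<xi>) = \<xi>"
  by (simp add: shift_def)

lemma shift_pow_prepend: "(shift ^^ length w) (prepend w \<xi>) = \<xi>"
  by (induction w) (simp_all add: prepend_def funpow_swap1)

lemma prepend_inf_words: "set w \<subseteq> {1..N} \<Longrightarrow> \<xi> \<in> inf_words N \<Longrightarrow> prepend w \<xi> \<in> inf_words N"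
  unfolding prepend_def
  by (induction w) (auto simp: inf_words_def image_subset_iff split: nat.split)

lemma shift_inf_words: "\<xi> \<in> inf_words N \<Longrightarrow> shift \<xi> \<in> inf_words N"
  by (auto simp: inf_words_def shift_def)

lemma map_upt_Suc_shift: "map \<omega> [0..<Suc m] = \<omega> 0 # map (shift \<omega>) [0..<m]"
  by (simp only: upt_conv_Cons[OF zero_less_Suc] list.map map_Suc_upt[symmetric] map_map)
     (simp add: shift_def comp_def)

locale homothetic_pcf_ifs =
  fixes F :: "nat \<Rightarrow> 'a::euclidean_space \<Rightarrow> 'a"
    and b :: "nat \<Rightarrow> 'a" and N :: nat and \<rho> :: real and K :: "'a set"
  assumes \<rho>: "0 < \<rho>" "\<rho> < 1"
    and F_eq: "\<And>i x. i \<in> {1..N} \<Longrightarrow> F i x = \<rho> *\<^sub>R (x - b i) + b i"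
    and K_ne: "K \<noteq> {}" and K_compact: "compact K" and K_eq: "K = (\<Union>i\<in>{1..N}. F i ` K)"
    and K_connected: "connected K"
    and K_pcf: "pcf F N K"
    and two_boundary_points: "2 \<le> card (V F N K 0)"
begin

abbreviation "V0 \<equiv> V F N K 0"
abbreviation "P \<equiv> postcritical_set F N K"
abbreviation cell where "cell w \<equiv> word_map F w ` K"

lemma F_inj: "i \<in> {1..N} \<Longrightarrow> F i x = F i y \<longleftrightarrow> x = y"
  using \<rho> by (simp add: F_eq)

lemma F_mem_K: "i \<in> {1..N} \<Longrightarrow> x \<in> K \<Longrightarrow> F i x \<in> K"
  using K_eq by blast

lemma word_map_diff:
  "set w \<subseteq> {1..N} \<Longrightarrow> word_map F w x - word_map F w y = \<rho> ^ length w *\<^sub>R (x - y)"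
proof (induction w)
  case Nil
  then show ?case by simp
next
  case (Cons i w)
  have "word_map F (i # w) x - word_map F (i # w) y
      = \<rho> *\<^sub>R (word_map F w x - word_map F w y)"
    using Cons.prems by (simp add: F_eq algebra_simps)
  then show ?case using Cons by simp
qed

lemma word_map_dist:
  "set w \<subseteq> {1..N} \<Longrightarrow> dist (word_map F w x) (word_map F w y) = \<rho> ^ length w * dist x y"
  using \<rho> by (simp add: dist_norm word_map_diff)

lemma word_map_mem_K: "set w \<subseteq> {1..N} \<Longrightarrow> x \<in> K \<Longrightarrow> word_map F w x \<in> K"
  by (induction w) (auto intro: F_mem_K)

lemma cell_append_subset: "set w \<subseteq> {1..N} \<Longrightarrow> cell (v @ w) \<subseteq> cell v"
  using word_map_mem_K[of w] by (auto simp: word_map_append)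

lemma cell_take_subset: "w \<in> words N n \<Longrightarrow> cell w \<subseteq> cell (take k w)"
  using cell_append_subset[of "drop k w" "take k w"] by (auto simp: words_def dest: in_set_dropD)

lemma cell_dist:
  assumes "w \<in> words N n" "y \<in> cell w" "z \<in> cell w"
  shows "dist y z \<le> \<rho> ^ n * diameter K"
proof -
  obtain y' z' where "y' \<in> K" "z' \<in> K" "y = word_map F w y'" "z = word_map F w z'"
    using assms by blast
  then show ?thesis
    using assms(1) \<rho> K_compact
    by (auto simp: words_def word_map_dist intro!: mult_left_mono diameter_bounded_bound compact_imp_bounded)
qed

lemma compact_cell: "set w \<subseteq> {1..N} \<Longrightarrow> compact (cell w)"
proof (induction w)
  case Nil
  then show ?case by (simp add: K_compact)
next
  case (Cons i w)
  have "continuous_on (cell w) (F i)"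
    using Cons.prems by (subst continuous_on_cong[OF refl, of _ _ "\<lambda>x. \<rho> *\<^sub>R (x - b i) + b i"])
      (auto simp: F_eq intro!: continuous_intros)
  then show ?case
    using Cons compact_continuous_image[of "cell w" "F i"] by (auto simp: image_comp)
qed

lemma prefix_in_words: "\<omega> \<in> inf_words N \<Longrightarrow> map \<omega> [0..<n] \<in> words N n"
  by (auto simp: inf_words_def words_def)

lemma coding_eqI:
  assumes \<omega>: "\<omega> \<in> inf_words N" and x: "\<And>n. x \<in> cell (map \<omega> [0..<n])"
  shows "coding F K \<omega> = x"
proof -
  have eq: "y = x" if "y \<in> (\<Inter>n. cell (map \<omega> [0..<n]))" for y
  proof -
    have "dist y x \<le> \<rho> ^ n * diameter K" for n
      using cell_dist[OF prefix_in_words[OF \<omega>]] x that by blast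
    moreover have "(\<lambda>n. \<rho> ^ n * diameter K) \<longlonglongrightarrow> 0 * diameter K"
      using \<rho> by (intro tendsto_intros LIMSEQ_power_zero) auto
    ultimately have "dist y x \<le> 0 * diameter K"
      by (intro LIMSEQ_le_const[of _ _ "dist y x"]) auto
    then show ?thesis by simp
  qed
  then have "(\<Inter>n. cell (map \<omega> [0..<n])) = {x}" using x by blast
  then show ?thesis unfolding coding_def by simp
qed

lemma coding_in_cell:
  assumes \<omega>: "\<omega> \<in> inf_words N"
  shows "coding F K \<omega> \<in> cell (map \<omega> [0..<n])"
proof -
  have "(\<Inter>n. cell (map \<omega> [0..<n])) \<noteq> {}"
  proof (rule compact_nest)
    show "compact (cell (map \<omega> [0..<n]))" for n
      using prefix_in_words[OF \<omega>] by (intro compact_cell) (auto simp: words_def)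
    show "cell (map \<omega> [0..<n]) \<noteq> {}" for n using K_ne by simp
    show "cell (map \<omega> [0..<n]) \<subseteq> cell (map \<omega> [0..<m])" if "m \<le> n" for m n
      using cell_take_subset[OF prefix_in_words[OF \<omega>], of n m] that by (simp add: take_map)
  qed
  then obtain x where "\<And>n. x \<in> cell (map \<omega> [0..<n])" by blast
  then show ?thesis using coding_eqI[OF \<omega>] by blast
qed

lemma coding_mem_K: "\<omega> \<in> inf_words N \<Longrightarrow> coding F K \<omega> \<in> K"
  using coding_in_cell[of \<omega> 0] by simp

lemma coding_shift:
  assumes \<omega>: "\<omega> \<in> inf_words N"
  shows "coding F K \<omega> = F (\<omega> 0) (coding F K (shift \<omega>))"
proof (rule coding_eqI[OF \<omega>])
  have \<omega>0: "\<omega> 0 \<in> {1..N}" using \<omega> unfolding inf_words_def by blast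
  show "F (\<omega> 0) (coding F K (shift \<omega>)) \<in> cell (map \<omega> [0..<n])" for n
  proof (cases n)
    case 0
    then show ?thesis using coding_mem_K[OF shift_inf_words[OF \<omega>]] \<omega>0 F_mem_K by simp
  next
    case (Suc m)
    then show ?thesis
      using coding_in_cell[OF shift_inf_words[OF \<omega>], of m] unfolding Suc map_upt_Suc_shift
      by auto
  qed
qed

lemma coding_prepend:
  assumes "set w \<subseteq> {1..N}" "\<xi> \<in> inf_words N"
  shows "coding F K (prepend w \<xi>) = word_map F w (coding F K \<xi>)"
  using assms(1)
proof (induction w)
  case Nil
  then show ?case by (simp add: prepend_def)
next
  case (Cons i w)
  have "coding F K (prepend (i # w) \<xi>) = F i (coding F K (prepend w \<xi>))"
    using coding_shift[OF prepend_inf_words[OF Cons.prems assms(2)]] by (simp add: prepend_def)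
  then show ?case using Cons by simp
qed

lemma coding_surj:
  assumes "x \<in> K"
  obtains \<omega> where "\<omega> \<in> inf_words N" "coding F K \<omega> = x"
proof -
  have "\<exists>i g. i \<in> {1..N} \<and> g \<in> K \<and> y = F i g" if "y \<in> K" for y
    using that by (subst (asm) K_eq) blast
  then obtain i g where ig: "\<And>y. y \<in> K \<Longrightarrow> i y \<in> {1..N} \<and> g y \<in> K \<and> y = F (i y) (g y)"
    by metis
  define y where "y = (\<lambda>n. (g ^^ n) x)"
  have y: "y n \<in> K" for n by (induction n) (use assms ig in \<open>auto simp: y_def\<close>)
  define \<omega> where "\<omega> = (\<lambda>n. i (y n))"
  have \<omega>: "\<omega> \<in> inf_words N" using ig y by (auto simp: inf_words_def \<omega>_def simp del: atLeastAtMost_iff)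
  have "x = word_map F (map \<omega> [0..<n]) (y n)" for n
  proof (induction n)
    case 0
    then show ?case by (simp add: y_def)
  next
    case (Suc n)
    have "y n = F (\<omega> n) (y (Suc n))" using ig[OF y[of n]] by (simp add: \<omega>_def y_def)
    then show ?case using Suc by (simp add: word_map_append)
  qed
  then have "coding F K \<omega> = x" using y by (intro coding_eqI[OF \<omega>]) blast
  then show ?thesis using that \<omega> by blast
qed

lemma P_subset: "P \<subseteq> inf_words N"
proof -
  have "(shift ^^ m) \<omega> \<in> inf_words N" if "\<omega> \<in> inf_words N" for m \<omega>
    using that by (induction m) (auto intro: shift_inf_words)
  then show ?thesis by (auto simp: postcritical_set_def critical_set_def)
qed

lemma finite_V0: "finite V0"
  using K_pcf by (simp add: pcf_def)

lemma V0_subset_K: "V0 \<subseteq> K"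
  using P_subset coding_mem_K by auto

lemma V0_ne: "V0 \<noteq> {}"
  using two_boundary_points by auto

lemma K_infinite: "infinite K"
proof
  assume "finite K"
  then obtain a where "K = {a}" using K_connected K_ne connected_finite_iff_sing by metis
  then have "V0 \<subseteq> {a}" using V0_subset_K by simp
  then have "card V0 \<le> 1" using card_mono[of "{a}" V0] by simp
  then show False using two_boundary_points by simp
qed

lemma V0_subset_V1: "V0 \<subseteq> V F N K (Suc 0)"
proof
  fix x assume "x \<in> V0"
  then obtain \<xi> where \<xi>: "\<xi> \<in> P" "x = coding F K \<xi>" by auto
  then obtain m \<omega> where "m \<ge> 1" "\<omega> \<in> critical_set F N K" "\<xi> = (shift ^^ m) \<omega>"
    by (auto simp: postcritical_set_def)
  then have "shift \<xi> \<in> P"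
    unfolding postcritical_set_def by (intro UN_I[of "Suc m"] image_eqI[of _ _ \<omega>]) auto
  moreover have "\<xi> \<in> inf_words N" using \<xi> P_subset by auto
  ultimately show "x \<in> V F N K (Suc 0)"
    using coding_shift[of \<xi>] \<xi>(2) by (auto simp: inf_words_def)
qed

section \<open>Cells meet only in boundary points\<close>
lemma critical_setI:
  assumes "\<omega> \<in> inf_words N" "i \<in> {1..N}" "j \<in> {1..N}" "i \<noteq> j" "coding F K \<omega> \<in> F i ` K \<inter> F j ` K"
  shows "\<omega> \<in> critical_set F N K"
proof -
  have "coding F K \<omega> \<in> F (min i j) ` K \<inter> F (max i j) ` K" "min i j \<in> {1..<max i j}" "max i j \<in> {1..N}"
    using assms by (auto simp: min_def max_def)
  then show ?thesis using assms(1) unfolding critical_set_def by blast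
qed

text \<open>
If \<open>\<xi>\<close> codes \<open>y\<close>, then \<open>i # w\<close> followed by \<open>\<xi>\<close> is a critical word, since it codes a point of
\<open>F\<^sub>i(K) \<inter> F\<^sub>j(K)\<close>.  Shifting the prefix away shows that \<open>\<xi>\<close> is postcritical.
\<close>
lemma overlap_in_V0:
  assumes i: "i \<in> {1..N}" "j \<in> {1..N}" "i \<noteq> j" and w: "set w \<subseteq> {1..N}"
    and y: "y \<in> K" and mem: "F i (word_map F w y) \<in> F j ` K"
  shows "y \<in> V0"
proof -
  obtain \<xi> where \<xi>: "\<xi> \<in> inf_words N" "coding F K \<xi> = y" using coding_surj[OF y] .
  define \<omega> where "\<omega> = prepend (i # w) \<xi>"
  have iw: "set (i # w) \<subseteq> {1..N}" using i w by auto
  have \<omega>: "\<omega> \<in> inf_words N" unfolding \<omega>_def by (rule prepend_inf_words[OF iw \<xi>(1)])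
  have "coding F K \<omega> = F i (word_map F w y)"
    unfolding \<omega>_def using coding_prepend[OF iw \<xi>(1)] \<xi>(2) by simp
  then have "coding F K \<omega> \<in> F i ` K \<inter> F j ` K"
    using mem word_map_mem_K[OF w y] by auto
  then have "\<omega> \<in> critical_set F N K"
    using \<omega> i by (intro critical_setI[of _ i j])
  then have "(shift ^^ length (i # w)) \<omega> \<in> P"
    unfolding postcritical_set_def by (intro UN_I[of "length (i # w)"]) auto
  then have "\<xi> \<in> P" unfolding \<omega>_def by (subst (asm) shift_pow_prepend)
  then show ?thesis using \<xi>(2) by auto
qed

lemma cell_overlap:
  assumes "w \<in> words N n" "w' \<in> words N n" "w \<noteq> w'"
    and "y \<in> K" "y' \<in> K" "word_map F w y = word_map F w' y'"
  shows "y \<in> V0"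
  using assms
proof (induction n arbitrary: w w')
  case 0
  then show ?case by simp
next
  case (Suc n)
  from Suc.prems(1) obtain i v where v: "w = i # v" "v \<in> words N n" "i \<in> {1..N}"
    by (auto simp: words_def length_Suc_conv)
  from Suc.prems(2) obtain j v' where v': "w' = j # v'" "v' \<in> words N n" "j \<in> {1..N}"
    by (auto simp: words_def length_Suc_conv)
  note w = v v'
  show ?case
  proof (cases "i = j")
    case True
    then have "word_map F v y = word_map F v' y'" using Suc.prems(6) w F_inj by simp
    then show ?thesis using Suc w True by blast
  next
    case False
    have "word_map F v' y' \<in> K" by (rule word_map_mem_K[OF words_set[OF v'(2)] Suc.prems(5)])
    then have "F i (word_map F v y) \<in> F j ` K" using Suc.prems(6) w by simp
    then show ?thesis by (rule overlap_in_V0[OF v(3) v'(3) False words_set[OF v(2)] Suc.prems(4)])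
  qed
qed

text \<open>
Equal maps would make a whole cell the overlap of two cells, hence part of the image of \<open>V0\<close>.
But \<open>V0\<close> is finite, and a connected set with two points is not.
\<close>
lemma no_exact_overlap:
  assumes "w \<in> words N n" "w' \<in> words N n" and "\<And>y. word_map F w y = word_map F w' y"
  shows "w = w'"
proof (rule ccontr)
  assume "w \<noteq> w'"
  then have "K \<subseteq> V0" using cell_overlap[OF assms(1,2)] assms(3) by blast
  then show False using K_infinite finite_V0 finite_subset by blast
qed

section \<open>Separation of cells\<close>
lemma touching_cells_translate:
  assumes "v \<in> words N n" "v' \<in> words N n" "cell v \<inter> cell v' \<noteq> {}"
  obtains a a' where "a \<in> V0" "a' \<in> V0" "word_map F v a = word_map F v' a'"
proof (cases "v = v'")
  case True
  then show ?thesis using that V0_ne by blast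
next
  case False
  obtain y y' where "y \<in> K" "y' \<in> K" "word_map F v y = word_map F v' y'" using assms(3) by blast
  then show ?thesis
    using that[of y y'] cell_overlap[OF assms(1,2) False, of y y']
      cell_overlap[OF assms(2,1), of y' y] False by auto
qed

text \<open>
At the first level where two cells are disjoint, their parents coincide or touch.  By
\<open>touching_cells_translate\<close> the relative position of the parents, rescaled to unit size, is a
translation by some \<open>t\<close> in the finite set \<open>V0 - V0\<close>.  So only finitely many pairs of
disjoint compact sets \<open>F i ` K\<close> and \<open>F j ` K + t\<close> occur, and \<open>\<delta>\<close> is a
common lower bound for their distances.
\<close>
lemma cells_separated:
  obtains \<delta> where "0 < \<delta>" and
    "\<And>n w w' y y'. \<lbrakk>w \<in> words N n; w' \<in> words N n; cell w \<inter> cell w' = {}; y \<in> cell w; y' \<in> cell w'\<rbrakk>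
       \<Longrightarrow> \<delta> * \<rho> ^ n \<le> dist y y'"
proof -
  define Q where "Q = {1..N} \<times> {1..N} \<times> (\<lambda>(a, a'). a - a') ` (V0 \<times> V0)"
  have "finite Q" unfolding Q_def using finite_V0 by auto
  define sep where "sep = (\<lambda>\<delta> (i, j, t).
    F i ` K \<inter> (\<lambda>x. x + t) ` F j ` K = {} \<longrightarrow> (\<forall>y\<in>K. \<forall>y'\<in>K. \<delta> \<le> dist (F i y) (F j y' + t)))"
  have "\<exists>\<delta>>0. sep \<delta> q" if q: "q \<in> Q" for q
  proof -
    obtain i j t where ijt: "q = (i, j, t)" "i \<in> {1..N}" "j \<in> {1..N}" using q by (auto simp: Q_def)
    have "compact (F i ` K)" "compact ((\<lambda>x. x + t) ` F j ` K)"
      using compact_cell[of "[i]"] compact_cell[of "[j]"] ijt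
      by (auto intro!: compact_continuous_image continuous_intros)
    then have "\<exists>\<delta>>0. \<forall>y\<in>F i ` K. \<forall>z\<in>(\<lambda>x. x + t) ` F j ` K. \<delta> \<le> dist y z"
      if "F i ` K \<inter> (\<lambda>x. x + t) ` F j ` K = {}"
      using separate_compact_closed[OF _ compact_imp_closed that] by blast
    then show ?thesis unfolding ijt sep_def by (cases "F i ` K \<inter> (\<lambda>x. x + t) ` F j ` K = {}") (auto intro: exI[of _ 1])
  qed
  then obtain d where d: "\<And>q. q \<in> Q \<Longrightarrow> 0 < d q \<and> sep (d q) q" by metis
  define \<delta> where "\<delta> = Min (insert 1 (d ` Q))"
  have \<delta>_pos: "0 < \<delta>" unfolding \<delta>_def using \<open>finite Q\<close> d by (subst Min_gr_iff) auto
  have \<delta>: "sep \<delta> q" if "q \<in> Q" for q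
  proof -
    have "\<delta> \<le> d q" unfolding \<delta>_def using \<open>finite Q\<close> that by (intro Min_le) auto
    then show ?thesis using d[OF that] unfolding sep_def by (auto split: prod.splits intro: order_trans)
  qed
  have main: "\<delta> * \<rho> ^ n \<le> dist y y'"
    if "w \<in> words N n" "w' \<in> words N n" "cell w \<inter> cell w' = {}" "y \<in> cell w" "y' \<in> cell w'" for n w w' y y'
    using that
  proof (induction n arbitrary: w w')
    case 0
    then show ?case using K_ne by simp
  next
    case (Suc n)
    from Suc.prems obtain v i where w: "w = v @ [i]" "v \<in> words N n" "i \<in> {1..N}"
      by (cases w rule: rev_cases) (auto simp: words_def)
    from Suc.prems obtain v' j where w': "w' = v' @ [j]" "v' \<in> words N n" "j \<in> {1..N}"
      by (cases w' rule: rev_cases) (auto simp: words_def)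
    have lens: "length v = n" "length v' = n" "set v \<subseteq> {1..N}" "set v' \<subseteq> {1..N}"
      using w w' by (auto simp: words_def)
    have "\<delta> * \<rho> ^ n \<le> dist y y'"
    proof (cases "cell v \<inter> cell v' = {}")
      case True
      show ?thesis
      proof (rule Suc.IH[OF w(2) w'(2) True])
        show "y \<in> cell v" using Suc.prems(4) cell_append_subset[of "[i]" v] w(1,3) by auto
        show "y' \<in> cell v'" using Suc.prems(5) cell_append_subset[of "[j]" v'] w'(1,3) by auto
      qed
    next
      case False
      then obtain a a' where a: "a \<in> V0" "a' \<in> V0" "word_map F v a = word_map F v' a'"
        using touching_cells_translate[OF w(2) w'(2)] by blast
      define t where "t = a - a'"
      have diff: "word_map F v z - word_map F v' z' = \<rho> ^ n *\<^sub>R (z - (z' + t))" for z z'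
      proof -
        have "word_map F v z - word_map F v' z'
            = (word_map F v z - word_map F v a) - (word_map F v' z' - word_map F v' a')"
          by (simp add: a(3))
        also have "\<dots> = \<rho> ^ n *\<^sub>R (z - a) - \<rho> ^ n *\<^sub>R (z' - a')"
          by (simp only: word_map_diff[OF lens(3)] word_map_diff[OF lens(4)] lens(1,2))
        also have "\<dots> = \<rho> ^ n *\<^sub>R (z - (z' + t))"
          by (simp add: t_def scaleR_diff_right[symmetric] algebra_simps del: scaleR_diff_right)
        finally show ?thesis .
      qed
      have "(i, j, t) \<in> Q" using w w' a by (auto simp: Q_def t_def)
      moreover have "F i ` K \<inter> (\<lambda>x. x + t) ` F j ` K = {}"
      proof -
        have False if "z \<in> K" "z' \<in> K" "F i z = F j z' + t" for z z'
        proof -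
          have "word_map F w z = word_map F w' z'"
            using diff[of "F i z" "F j z'"] that w w' by (simp add: word_map_append)
          then show False using that Suc.prems(3) by auto
        qed
        then show ?thesis by auto
      qed
      ultimately have *: "\<delta> \<le> dist (F i z) (F j z' + t)" if "z \<in> K" "z' \<in> K" for z z'
        using \<delta>[of "(i, j, t)"] that by (auto simp: sep_def)
      obtain z z' where z: "z \<in> K" "z' \<in> K" "y = word_map F v (F i z)" "y' = word_map F v' (F j z')"
        using Suc.prems w w' by (auto simp: word_map_append)
      have "dist y y' = \<rho> ^ n * dist (F i z) (F j z' + t)"
        using diff[of "F i z" "F j z'"] z \<rho> by (simp add: dist_norm)
      then show ?thesis using *[OF z(1,2)] \<rho> by (simp add: mult.commute mult_right_mono)
    qed
    moreover have "\<delta> * \<rho> ^ Suc n \<le> \<delta> * \<rho> ^ n"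
      using \<delta>_pos \<rho> by (intro mult_left_mono power_decreasing) auto
    ultimately show ?case by linarith
  qed
  show ?thesis by (rule that[OF \<delta>_pos main])
qed

text \<open>
The translation vector determines the neighbour, as distinct words of the same length give
distinct maps.
\<close>
lemma card_touching_cells:
  assumes v: "v \<in> words N n"
  shows "card {v' \<in> words N n. cell v \<inter> cell v' \<noteq> {}} \<le> (card V0)\<^sup>2"
proof -
  let ?T = "{v' \<in> words N n. cell v \<inter> cell v' \<noteq> {}}"
  have "\<exists>p\<in>V0 \<times> V0. word_map F v (fst p) = word_map F v' (snd p)" if "v' \<in> ?T" for v'
  proof -
    obtain a a' where "a \<in> V0" "a' \<in> V0" "word_map F v a = word_map F v' a'"
      using touching_cells_translate[OF v, of v'] \<open>v' \<in> ?T\<close> by blast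
    then show ?thesis by (intro bexI[of _ "(a, a')"]) auto
  qed
  then have "\<forall>v'\<in>?T. \<exists>p. p \<in> V0 \<times> V0 \<and> word_map F v (fst p) = word_map F v' (snd p)"
    by blast
  from bchoice[OF this] obtain f where
    f: "\<And>v'. v' \<in> ?T \<Longrightarrow> f v' \<in> V0 \<times> V0 \<and> word_map F v (fst (f v')) = word_map F v' (snd (f v'))"
    by blast
  have "inj_on f ?T"
  proof (rule inj_onI)
    fix v1 v2 assume 1: "v1 \<in> ?T" "v2 \<in> ?T" "f v1 = f v2"
    define a where "a = snd (f v1)"
    have a: "word_map F v1 a = word_map F v2 a" using f[OF 1(1)] f[OF 1(2)] 1(3) by (simp add: a_def)
    have "word_map F v1 y = word_map F v2 y" for y
      using word_map_diff[of v1 y a] word_map_diff[of v2 y a] 1(1,2) a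
      by (simp add: words_def) (metis diff_add_cancel)
    then show "v1 = v2" using no_exact_overlap 1 by blast
  qed
  moreover have "f ` ?T \<subseteq> V0 \<times> V0" using f by blast
  moreover have "finite (V0 \<times> V0)" using finite_V0 by (rule finite_cartesian_product[OF _ finite_V0])
  ultimately have "card ?T \<le> card (V0 \<times> V0)" by (rule card_inj_on_le)
  then show ?thesis by (simp add: card_cartesian_product power2_eq_square)
qed

text \<open>
Cells meeting \<open>U\<close> are within \<open>D * \<rho>^n\<close> of each other.  Their ancestors \<open>k\<close> levels higher would be
at distance at least \<open>\<delta> * \<rho>^(n-k)\<close> if they were disjoint; with \<open>D * \<rho>^k < \<delta>\<close> they therefore
touch, and each ancestor has at most \<open>N^k\<close> descendants.  If \<open>n < k\<close>, the truncated difference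
\<open>n - k = 0\<close> makes \<open>K\<close> itself the common ancestor.
\<close>
lemma bounded_overlap:
  "\<exists>M. \<forall>n U. (\<forall>y\<in>U. \<forall>z\<in>U. dist y z \<le> D * \<rho> ^ n) \<longrightarrow>
     card {w \<in> words N n. cell w \<inter> U \<noteq> {}} \<le> M"
proof -
  obtain \<delta> where \<delta>: "0 < \<delta>" and sep:
    "\<And>n w w' y y'. \<lbrakk>w \<in> words N n; w' \<in> words N n; cell w \<inter> cell w' = {}; y \<in> cell w; y' \<in> cell w'\<rbrakk>
       \<Longrightarrow> \<delta> * \<rho> ^ n \<le> dist y y'"
    using cells_separated by blast
  have "(\<lambda>k. D * \<rho> ^ k) \<longlonglongrightarrow> D * 0" using \<rho> by (intro tendsto_intros LIMSEQ_power_zero) auto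
  then have "eventually (\<lambda>k. D * \<rho> ^ k < \<delta>) sequentially" using \<delta> by (intro order_tendstoD) auto
  then obtain k where k: "D * \<rho> ^ k < \<delta>" unfolding eventually_sequentially by blast
  have N: "1 \<le> N" using K_ne K_eq by (cases N) auto
  have "card {w \<in> words N n. cell w \<inter> U \<noteq> {}} \<le> (card V0)\<^sup>2 * N ^ k"
    if U: "\<forall>y\<in>U. \<forall>z\<in>U. dist y z \<le> D * \<rho> ^ n" for n U
  proof (cases "{w \<in> words N n. cell w \<inter> U \<noteq> {}} = {}")
    case True
    then show ?thesis by (simp only: card.empty)
  next
    case False
    then obtain w y where w: "w \<in> words N n" "y \<in> cell w" "y \<in> U" by blast
    define m where "m = n - k"
    define T where "T = {v' \<in> words N m. cell (take m w) \<inter> cell v' \<noteq> {}}"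
    have takew: "take m w \<in> words N m" using take_words[OF w(1)] by (simp add: m_def)
    have near: "take m w' \<in> T" if w': "w' \<in> words N n" "cell w' \<inter> U \<noteq> {}" for w'
    proof -
      obtain y' where y': "y' \<in> cell w'" "y' \<in> U" using w'(2) by blast
      have takew': "take m w' \<in> words N m" using take_words[OF w'(1)] by (simp add: m_def)
      show ?thesis
      proof (rule ccontr)
        assume "take m w' \<notin> T"
        then have disj: "cell (take m w) \<inter> cell (take m w') = {}" using takew' by (auto simp: T_def)
        then have "m \<noteq> 0" using K_ne by (intro notI) simp
        then have n: "n = m + k" by (simp add: m_def)
        have "\<delta> * \<rho> ^ m \<le> dist y y'"
          using sep[OF takew takew' disj] cell_take_subset[OF w(1)] cell_take_subset[OF w'(1)] w(2) y'(1)
          by blast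
        also have "\<dots> \<le> D * \<rho> ^ n" using U w(3) y'(2) by blast
        also have "\<dots> = (D * \<rho> ^ k) * \<rho> ^ m" by (simp add: n power_add)
        also have "\<dots> < \<delta> * \<rho> ^ m" using k \<rho> by (intro mult_strict_right_mono) auto
        finally show False by simp
      qed
    qed
    have "card {w \<in> words N n. cell w \<inter> U \<noteq> {}} \<le> card (T \<times> words N (n - m))"
    proof (rule card_inj_on_le[of "\<lambda>w. (take m w, drop m w)"])
      show "inj_on (\<lambda>w. (take m w, drop m w)) {w \<in> words N n. cell w \<inter> U \<noteq> {}}"
        by (rule inj_onI) (metis append_take_drop_id prod.inject)
      show "(\<lambda>w. (take m w, drop m w)) ` {w \<in> words N n. cell w \<inter> U \<noteq> {}} \<subseteq> T \<times> words N (n - m)"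
        using near drop_words by auto
      show "finite (T \<times> words N (n - m))" by (auto simp: T_def finite_words)
    qed
    also have "\<dots> = card T * N ^ (n - m)" by (simp add: card_cartesian_product card_words)
    also have "\<dots> \<le> (card V0)\<^sup>2 * N ^ k"
      unfolding T_def using card_touching_cells[OF takew] N
      by (intro mult_le_mono power_increasing) (auto simp: m_def)
    finally show ?thesis .
  qed
  then show ?thesis by blast
qed

section \<open>Hausdorff measure of subsets of the self-similar set\<close>

text \<open>
The \<open>N^n\<close> cells of level \<open>n\<close> form a cover; their \<open>s\<close>-sum is at most a constant times
\<open>(N * \<rho> powr s)^n\<close>.
\<close>
lemma hausdorff_measure_eq_0:
  assumes A: "A \<subseteq> K" and s: "0 < s" "real N * \<rho> powr s < 1"
  shows "hausdorff_measure s A = 0"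
proof -
  define Dm where "Dm = diameter K"
  have Dm: "0 \<le> Dm" unfolding Dm_def using K_compact by (intro diameter_ge_0 compact_imp_bounded)
  define f where "f = (\<lambda>n. (real N * \<rho> powr s) ^ n * Dm powr s)"
  have "f \<longlonglongrightarrow> 0 * Dm powr s"
    unfolding f_def using s \<rho> by (intro tendsto_intros LIMSEQ_power_zero) auto
  then have f_lim: "(\<lambda>n. ennreal (f n)) \<longlonglongrightarrow> ennreal 0" by (intro tendsto_ennrealI) simp
  have "hausdorff_premeasure s \<delta> A \<le> 0" if \<delta>: "0 < \<delta>" for \<delta>
  proof -
    have "(\<lambda>n. \<rho> ^ n * Dm) \<longlonglongrightarrow> 0 * Dm" using \<rho> by (intro tendsto_intros LIMSEQ_power_zero) auto
    then have "eventually (\<lambda>n. \<rho> ^ n * Dm < \<delta>) sequentially" using \<delta> by (intro order_tendstoD) auto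
    then obtain n0 where n0: "\<And>n. n \<ge> n0 \<Longrightarrow> \<rho> ^ n * Dm < \<delta>"
      unfolding eventually_sequentially by blast
    have "hausdorff_premeasure s \<delta> A \<le> ennreal (f n)" if n: "n \<ge> n0" for n
    proof -
      (* The definition of the premeasure asks for covers indexed by the natural numbers. *)
      define C where "C = (to_nat :: nat list \<Rightarrow> nat) ` words N n"
      define U where "U = (\<lambda>i. if i \<in> C then cell (from_nat i) else {})"
      have bd: "bounded (cell w)" if "w \<in> words N n" for w
        using compact_cell[OF words_set[OF that]] by (rule compact_imp_bounded)
      have diam: "diameter (cell w) \<le> \<rho> ^ n * Dm" if "w \<in> words N n" for w
        unfolding Dm_def using cell_dist[OF that] K_ne by (intro diameter_le) (auto simp: dist_norm)
      have "A \<subseteq> (\<Union>i. U i)"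
      proof
        fix y assume "y \<in> A"
        then obtain \<omega> where \<omega>: "\<omega> \<in> inf_words N" "coding F K \<omega> = y" using A coding_surj by blast
        then have "y \<in> U (to_nat (map \<omega> [0..<n]))"
          using coding_in_cell[of \<omega> n] prefix_in_words[of \<omega> n] by (simp add: U_def C_def)
        then show "y \<in> (\<Union>i. U i)" by blast
      qed
      moreover have "bounded (U i) \<and> diameter (U i) \<le> \<delta>" for i
      proof (cases "i \<in> C")
        case True
        then obtain w where w: "i = to_nat w" "w \<in> words N n" by (auto simp: C_def)
        then show ?thesis using bd[OF w(2)] diam[OF w(2)] n0[OF n] True by (simp add: U_def)
      qed (use \<delta> in \<open>simp add: U_def\<close>)
      ultimately have "hausdorff_premeasure s \<delta> A \<le> (\<Sum>i. diam_powr s (U i))"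
        unfolding hausdorff_premeasure_def by (intro INF_lower) auto
      also have "\<dots> = (\<Sum>i\<in>C. diam_powr s (U i))"
        by (rule suminf_finite) (auto simp: C_def U_def diam_powr_def finite_words)
      also have "\<dots> = (\<Sum>w\<in>words N n. diam_powr s (cell w))"
        unfolding C_def by (subst sum.reindex) (auto simp: U_def C_def)
      also have "\<dots> \<le> (\<Sum>w\<in>words N n. ennreal ((\<rho> ^ n * Dm) powr s))"
      proof (rule sum_mono)
        fix w assume w: "w \<in> words N n"
        have "diameter (cell w) powr s \<le> (\<rho> ^ n * Dm) powr s"
          using diam[OF w] s diameter_ge_0[OF bd[OF w]] by (intro powr_mono2) auto
        then show "diam_powr s (cell w) \<le> ennreal ((\<rho> ^ n * Dm) powr s)"
          using s K_ne by (simp add: diam_powr_def ennreal_leI)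
      qed
      also have "\<dots> = ennreal (real (N ^ n) * (\<rho> ^ n * Dm) powr s)"
        by (subst sum_ennreal) (auto simp: card_words)
      also have "real (N ^ n) * (\<rho> ^ n * Dm) powr s = f n"
        using \<rho> Dm by (simp add: f_def powr_mult power_mult_distrib powr_power powr_powr
            powr_realpow[symmetric] mult.commute)
      finally show ?thesis .
    qed
    then show ?thesis using f_lim by (intro LIMSEQ_le_const) auto
  qed
  then show ?thesis by (simp add: hausdorff_measure_def)
qed

text \<open>
Guarantees that the infimum which defines the dimension ranges over a nonempty set.
\<close>
lemma ex_null_exponent:
  assumes "A \<subseteq> K"
  obtains s where "0 < s" "hausdorff_measure s A = 0"
proof -
  have "(\<lambda>k. real N * \<rho> ^ k) \<longlonglongrightarrow> real N * 0" using \<rho> by (intro tendsto_intros LIMSEQ_power_zero) auto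
  then have "eventually (\<lambda>k. real N * \<rho> ^ k < 1) sequentially" by (intro order_tendstoD) auto
  then obtain k where k: "k \<ge> 1" "real N * \<rho> ^ k < 1"
    unfolding eventually_sequentially by (metis nat_le_linear)
  then show ?thesis
    using that[of "real k"] hausdorff_measure_eq_0[OF assms, of "real k"] \<rho> by (simp add: powr_realpow)
qed

lemma hausdorff_dim_ge_0:
  assumes "A \<subseteq> K"
  shows "0 \<le> hausdorff_dim A"
proof -
  obtain s where "0 < s" "hausdorff_measure s A = 0" using ex_null_exponent[OF assms] .
  then have "s \<in> {s. 0 \<le> s \<and> hausdorff_measure s A = 0}" by simp
  then show ?thesis unfolding hausdorff_dim_def by (intro cInf_greatest) auto
qed

lemma ex_null_exponent_near_dim:
  assumes "A \<subseteq> K" "hausdorff_dim A < t"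
  obtains s where "0 \<le> s" "s < t" "hausdorff_measure s A = 0"
proof -
  let ?S = "{s. 0 \<le> s \<and> hausdorff_measure s A = 0}"
  obtain s0 where "0 < s0" "hausdorff_measure s0 A = 0" using ex_null_exponent[OF assms(1)] .
  then have "s0 \<in> ?S" by simp
  moreover have "bdd_below ?S" by (rule bdd_belowI[of _ 0]) auto
  ultimately obtain s where "s \<in> ?S" "s < t"
    using assms(2) cInf_less_iff[of ?S t] unfolding hausdorff_dim_def by blast
  then show ?thesis using that by blast
qed

section \<open>Boundary classes and their traces on cells\<close>
lemma V_mono: "m \<le> n \<Longrightarrow> V F N K m \<subseteq> V F N K n"
proof (rule lift_Suc_mono_le[of "V F N K"])
  show "V F N K n \<subseteq> V F N K (Suc n)" for n
  proof (induction n)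
    case 0
    show ?case by (rule V0_subset_V1)
  next
    case (Suc n)
    then have "(\<Union>i\<in>{1..N}. F i ` V F N K n) \<subseteq> (\<Union>i\<in>{1..N}. F i ` V F N K (Suc n))" by blast
    then show ?case by simp
  qed
qed

lemma V_subset_K: "V F N K n \<subseteq> K"
proof (induction n)
  case 0
  show ?case by (rule V0_subset_K)
next
  case (Suc n)
  then show ?case using F_mem_K by auto
qed

lemma F_mem_V: "i \<in> {1..N} \<Longrightarrow> x \<in> V F N K n \<Longrightarrow> F i x \<in> V F N K (Suc n)"
  by auto

lemma V0_preimage:
  assumes "x \<in> V0"
  obtains i y where "i \<in> {1..N}" "y \<in> V0" "x = F i y"
proof -
  have "x \<in> (\<Union>i\<in>{1..N}. F i ` V0)"
    using subsetD[OF V0_subset_V1 assms] unfolding V.simps(2) .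
  then show ?thesis using that by blast
qed

end

locale boundary_relation = homothetic_pcf_ifs +
  fixes S :: "'a rel"
  assumes S_equiv: "equiv (V F N K 0) S"
begin

abbreviation "E n \<equiv> sim_level F N K S n"
abbreviation sim (infix "\<simeq>" 50) where "x \<simeq> y \<equiv> (x, y) \<in> sim_star F N K S"

text \<open>
The form in which the minimality of the generated relations is used.
\<close>
lemma sim_level_least:
  assumes "equiv (V F N K (Suc n)) T"
    and "\<And>x y. (x, y) \<in> E n \<Longrightarrow> (x, y) \<in> T"
    and "\<And>x y i. (x, y) \<in> E n \<Longrightarrow> i \<in> {1..N} \<Longrightarrow> (F i x, F i y) \<in> T"
  shows "E (Suc n) \<subseteq> T"
  unfolding sim_level.simps(2) by (rule Inter_lower) (use assms in blast)

lemma sim_level_equiv: "equiv (V F N K n) (E n)"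
proof (induction n)
  case 0
  then show ?case using S_equiv by simp
next
  case (Suc n)
  define \<T> where "\<T> = {T. equiv (V F N K (Suc n)) T \<and>
    (\<forall>x y. (x, y) \<in> E n \<longrightarrow> (x, y) \<in> T \<and> (\<forall>i\<in>{1..N}. (F i x, F i y) \<in> T))}"
  have E: "E (Suc n) = \<Inter>\<T>" unfolding \<T>_def by (rule sim_level.simps(2))
  have sub: "E n \<subseteq> V F N K n \<times> V F N K n" using Suc by (auto elim: equivE)
  have "V F N K (Suc n) \<times> V F N K (Suc n) \<in> \<T>"
  proof -
    have "equiv (V F N K (Suc n)) (V F N K (Suc n) \<times> V F N K (Suc n))"
      by (auto intro!: equivI refl_onI symI transI simp del: V.simps)
    moreover have "x \<in> V F N K (Suc n) \<and> (\<forall>i\<in>{1..N}. F i x \<in> V F N K (Suc n))"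
      if "x \<in> V F N K n" for x
      using that V_mono[of n "Suc n"] F_mem_V[of _ x n] by (auto simp del: V.simps)
    ultimately show ?thesis unfolding \<T>_def using sub by blast
  qed
  moreover have eq: "equiv (V F N K (Suc n)) T" if "T \<in> \<T>" for T
    using that unfolding \<T>_def by blast
  ultimately have "E (Suc n) \<subseteq> V F N K (Suc n) \<times> V F N K (Suc n)"
    unfolding E by (intro Inter_lower)
  moreover have "refl_on (V F N K (Suc n)) (E (Suc n))"
    unfolding E refl_on_def using eq by (blast elim: equivE dest: refl_onD)
  moreover have "sym (E (Suc n))"
    unfolding E using eq by (intro symI InterI) (blast elim: equivE dest: symD)
  moreover have "trans (E (Suc n))"
    unfolding E using eq by (intro transI InterI) (blast elim: equivE dest: transD)
  ultimately show ?case by (rule equivI)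
qed

lemma sim_level_mem: "(x, y) \<in> E n \<Longrightarrow> x \<in> V F N K n \<and> y \<in> V F N K n"
  using sim_level_equiv[of n] unfolding equiv_def by blast

lemma sim_level_Suc: "(x, y) \<in> E n \<Longrightarrow> (x, y) \<in> E (Suc n)"
  unfolding sim_level.simps(2) by blast

lemma sim_level_F: "(x, y) \<in> E n \<Longrightarrow> i \<in> {1..N} \<Longrightarrow> (F i x, F i y) \<in> E (Suc n)"
  unfolding sim_level.simps(2) by blast

lemma sim_level_mono: "m \<le> n \<Longrightarrow> E m \<subseteq> E n"
  by (rule lift_Suc_mono_le[of E]) (auto dest: sim_level_Suc simp del: sim_level.simps)

lemma sim_iff: "x \<simeq> y \<longleftrightarrow> (\<exists>n. (x, y) \<in> E n)"
  unfolding sim_star_def using sim_level_mem by blast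

lemma sim_refl: "x \<in> Vstar F N K \<Longrightarrow> x \<simeq> x"
  using sim_level_equiv unfolding sim_iff Vstar_def equiv_def refl_on_def by blast

lemma sim_sym: "x \<simeq> y \<Longrightarrow> y \<simeq> x"
  using sim_level_equiv unfolding sim_iff equiv_def sym_def by blast

lemma sim_trans:
  assumes "x \<simeq> y" "y \<simeq> z"
  shows "x \<simeq> z"
proof -
  obtain m n where "(x, y) \<in> E m" "(y, z) \<in> E n" using assms by (auto simp: sim_iff)
  then have "(x, y) \<in> E (max m n)" "(y, z) \<in> E (max m n)"
    using sim_level_mono[of m "max m n"] sim_level_mono[of n "max m n"] by auto
  then have "(x, z) \<in> E (max m n)"
    using sim_level_equiv[of "max m n"] unfolding equiv_def trans_def by blast
  then show ?thesis unfolding sim_iff by blast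
qed

lemma sim_F: "x \<simeq> y \<Longrightarrow> i \<in> {1..N} \<Longrightarrow> F i x \<simeq> F i y"
  unfolding sim_iff using sim_level_F by blast

lemma sim_Vstar: "x \<simeq> y \<Longrightarrow> x \<in> Vstar F N K \<and> y \<in> Vstar F N K"
  unfolding sim_iff Vstar_def using sim_level_mem by blast

lemma V0_Vstar: "x \<in> V0 \<Longrightarrow> x \<in> Vstar F N K"
  unfolding Vstar_def by blast

lemma Vstar_K: "x \<in> Vstar F N K \<Longrightarrow> x \<in> K"
  unfolding Vstar_def using V_subset_K by blast

lemma Vstar_F: "x \<in> Vstar F N K \<Longrightarrow> i \<in> {1..N} \<Longrightarrow> F i x \<in> Vstar F N K"
  unfolding Vstar_def using F_mem_V by blast

text \<open>
A chain of equivalences from a point of the cell \<open>F i ` K\<close> to a boundary point of \<open>K\<close> can be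
factored through the boundary of that cell.  Instead of handling chains, the proof considers
the set \<open>B\<close> of all points with such a factorisation and shows that it is closed under every
\<open>sim_level\<close>: "belonging to \<open>B\<close> simultaneously" is an equivalence relation which contains the
generators.  A point of \<open>B\<close> that lies in two cells is a boundary point of each, and then it can
serve as its own exit point.
\<close>
lemma sim_boundary_factor:
  assumes a: "a \<in> V0" and i: "i \<in> {1..N}" and x: "x \<in> Vstar F N K"
  shows "F i x \<simeq> a \<longleftrightarrow> (\<exists>b\<in>V0. x \<simeq> b \<and> F i b \<simeq> a)"
proof
  assume "\<exists>b\<in>V0. x \<simeq> b \<and> F i b \<simeq> a"
  then show "F i x \<simeq> a" using sim_F[OF _ i] sim_trans by blast
next
  assume Fx: "F i x \<simeq> a"
  define B where "B = {z. \<exists>j\<in>{1..N}. \<exists>y\<in>Vstar F N K. \<exists>b\<in>V0. z = F j y \<and> y \<simeq> b \<and> F j b \<simeq> a}"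
  have BI: "F j y \<in> B" if "j \<in> {1..N}" "y \<simeq> b" "b \<in> V0" "F j b \<simeq> a" for j y b
    unfolding B_def using that sim_Vstar by blast
  have B_sim: "z \<simeq> a" if "z \<in> B" for z
    using that unfolding B_def using sim_F sim_trans by blast
  have V0_B: "w \<in> B" if "w \<in> V0" "w \<simeq> a" for w
  proof -
    obtain j y where "j \<in> {1..N}" "y \<in> V0" "w = F j y" using V0_preimage[OF \<open>w \<in> V0\<close>] by blast
    then show ?thesis using BI[of j y y] sim_refl V0_Vstar that by blast
  qed
  have alt: "(i = j \<and> x = y) \<or> x \<in> V0"
    if "F i x = F j y" "i \<in> {1..N}" "j \<in> {1..N}" "x \<in> Vstar F N K" "y \<in> Vstar F N K" for i j x y
  proof (cases "i = j")
    case True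
    then show ?thesis using that F_inj by simp
  next
    case False
    then show ?thesis using overlap_in_V0[OF that(2,3) False, of "[]" x] that Vstar_K by auto
  qed
  have B_F: "F i y \<in> B" if "F i x \<in> B" "x \<simeq> y" "i \<in> {1..N}" for i x y
  proof -
    obtain j x' b where B: "j \<in> {1..N}" "x' \<in> Vstar F N K" "b \<in> V0" "F i x = F j x'" "x' \<simeq> b" "F j b \<simeq> a"
      using \<open>F i x \<in> B\<close> unfolding B_def by blast
    from alt[OF B(4) that(3) B(1) _ B(2)] sim_Vstar[OF that(2)]
    consider "i = j" "x = x'" | "x \<in> V0" by blast
    then show ?thesis
    proof cases
      case 1
      then show ?thesis using BI[of i y b] that B sim_sym sim_trans by blast
    next
      case 2
      then show ?thesis using BI[of i y x] that B_sim sim_sym by blast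
    qed
  qed
  have B_closed: "(z, w) \<in> E n \<Longrightarrow> z \<in> B \<Longrightarrow> w \<in> B" for z w n
  proof (induction n arbitrary: z w)
    case 0
    then have "w \<in> V0" "z \<simeq> w" using sim_level_mem[of z w 0] sim_iff by blast+
    then show ?case using V0_B B_sim[OF 0(2)] sim_sym sim_trans by blast
  next
    case (Suc n)
    let ?W = "V F N K (Suc n)"
    define T where "T = {(z, w). z \<in> ?W \<and> w \<in> ?W \<and> (z \<in> B \<longleftrightarrow> w \<in> B)}"
    have sym: "(y, x) \<in> E n" if "(x, y) \<in> E n" for x y
      using that sim_level_equiv[of n] unfolding equiv_def sym_def by blast
    have "E (Suc n) \<subseteq> T"
    proof (rule sim_level_least)
      show "equiv ?W T"
        unfolding T_def by (auto intro!: equivI refl_onI symI transI simp del: V.simps)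
      show "(x, y) \<in> T" if "(x, y) \<in> E n" for x y
        using that sym[OF that] Suc.IH sim_level_mem[OF sim_level_Suc[OF that]] unfolding T_def by blast
      show "(F i x, F i y) \<in> T" if "(x, y) \<in> E n" "i \<in> {1..N}" for x y i
      proof -
        have "x \<simeq> y" using that(1) sim_iff by blast
        then show ?thesis
          using B_F[OF _ _ that(2)] sim_sym[of x y] sim_level_mem[OF sim_level_F[OF that]]
          unfolding T_def by blast
      qed
    qed
    then show ?case using Suc.prems unfolding T_def by blast
  qed
  have "a \<in> B" using V0_B[OF a] sim_refl V0_Vstar[OF a] by blast
  then have "F i x \<in> B" using B_closed sim_sym[OF Fx] unfolding sim_iff by blast
  then obtain j x' b where B: "j \<in> {1..N}" "x' \<in> Vstar F N K" "b \<in> V0" "F i x = F j x'" "x' \<simeq> b" "F j b \<simeq> a"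
    unfolding B_def by blast
  from alt[OF B(4) i B(1) x B(2)] show "\<exists>b\<in>V0. x \<simeq> b \<and> F i b \<simeq> a"
    using B Fx sim_refl[OF x] by blast
qed

text \<open>
The transition function of the automaton, whose states are the possible traces.
\<close>

definition trace_step :: "nat \<Rightarrow> 'a set \<Rightarrow> 'a set" where
  "trace_step i A = {b \<in> V0. \<exists>a\<in>A. F i b \<simeq> a}"

definition cell_trace :: "'a set \<Rightarrow> nat list \<Rightarrow> 'a set" where
  "cell_trace J w = {a \<in> V0. word_map F w a \<in> J}"

lemma boundary_class_mem:
  assumes J: "boundary_class F N K S J" and v: "v \<in> J"
  shows "x \<in> J \<longleftrightarrow> v \<simeq> x"
proof -
  obtain c where c: "J = sim_star F N K S `` {c}"
    using J unfolding boundary_class_def quotient_def by blast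
  then have "c \<simeq> v" using v by blast
  then show ?thesis using c sim_sym sim_trans by blast
qed

lemma boundary_class_subset_K: "boundary_class F N K S J \<Longrightarrow> J \<subseteq> K"
  using boundary_class_mem sim_Vstar Vstar_K by blast

text \<open>
The trace on the boundary of a cell determines the class inside the cell.  For the empty word
this uses that \<open>J\<close> is a boundary class; each further letter is an application of
\<open>sim_boundary_factor\<close> to the points of the trace.
\<close>
lemma word_map_mem_class:
  assumes J: "boundary_class F N K S J"
    and "set w \<subseteq> {1..N}" and "x \<in> Vstar F N K"
  shows "word_map F w x \<in> J \<longleftrightarrow> (\<exists>a\<in>cell_trace J w. x \<simeq> a)"
  using assms(2,3)
proof (induction w arbitrary: x rule: rev_induct)
  case Nil
  obtain v where "v \<in> J" "v \<in> V0" using J unfolding boundary_class_def by blast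
  then have "x \<in> J \<longleftrightarrow> (\<exists>a\<in>J \<inter> V0. x \<simeq> a)"
    using boundary_class_mem[OF J] sim_sym by blast
  moreover have "cell_trace J [] = J \<inter> V0" unfolding cell_trace_def by auto
  ultimately show ?case by simp
next
  case (snoc i w)
  have w: "set w \<subseteq> {1..N}" and i: "i \<in> {1..N}" using snoc.prems by auto
  have IH: "word_map F w (F i y) \<in> J \<longleftrightarrow> (\<exists>a\<in>cell_trace J w. F i y \<simeq> a)" if "y \<in> Vstar F N K" for y
    using snoc.IH[OF w Vstar_F[OF that i]] .
  have "word_map F (w @ [i]) x \<in> J \<longleftrightarrow> (\<exists>a\<in>cell_trace J w. F i x \<simeq> a)"
    using IH[OF snoc.prems(2)] by (simp add: word_map_append)
  also have "\<dots> \<longleftrightarrow> (\<exists>a\<in>cell_trace J w. \<exists>b\<in>V0. x \<simeq> b \<and> F i b \<simeq> a)"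
    using sim_boundary_factor[OF _ i snoc.prems(2)] by (auto simp: cell_trace_def)
  also have "\<dots> \<longleftrightarrow> (\<exists>b\<in>V0. x \<simeq> b \<and> word_map F w (F i b) \<in> J)"
    using IH V0_Vstar by blast
  also have "\<dots> \<longleftrightarrow> (\<exists>b\<in>cell_trace J (w @ [i]). x \<simeq> b)"
    by (auto simp: cell_trace_def word_map_append)
  finally show ?case .
qed

lemma cell_trace_fold:
  assumes J: "boundary_class F N K S J" and "set w \<subseteq> {1..N}"
  shows "cell_trace J w = fold trace_step w (J \<inter> V0)"
  using assms(2)
proof (induction w rule: rev_induct)
  case Nil
  then show ?case by (auto simp: cell_trace_def)
next
  case (snoc i w)
  then have w: "set w \<subseteq> {1..N}" and i: "i \<in> {1..N}" by auto
  have "word_map F (w @ [i]) b \<in> J \<longleftrightarrow> (\<exists>a\<in>cell_trace J w. F i b \<simeq> a)" if "b \<in> V0" for b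
    using word_map_mem_class[OF J w Vstar_F[OF V0_Vstar[OF that] i]] by (simp add: word_map_append)
  then have "cell_trace J (w @ [i]) = trace_step i (cell_trace J w)"
    unfolding trace_step_def cell_trace_def[of J "w @ [i]"] by blast
  then show ?case using snoc.IH[OF w] by simp
qed

text \<open>
A cover of \<open>closure J\<close> is turned into the cutset \<open>W\<close> of all words whose cell has the scale of
some set of the cover and meets that set.  A long accepted word \<open>v\<close> has a point of \<open>J\<close> in its
cell; the prefix of \<open>v\<close> at the scale of the set covering this point belongs to \<open>W\<close>.
\<close>
proposition class_cell_count:
  assumes J: "boundary_class F N K S J" and s: "0 \<le> s"
    and fin: "hausdorff_measure s (closure J) < \<infinity>"
  obtains B where
    "\<And>n. (\<rho> powr s) ^ n * real (card {w \<in> words N n. J \<inter> Vcell F N K w \<noteq> {}}) \<le> B"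
proof -
  define x where "x = \<rho> powr s"
  have x: "0 < x" using \<rho> by (simp add: x_def)
  interpret aut: weighted_automaton "Pow V0" N trace_step "\<lambda>A. A \<noteq> {}" x
    using finite_V0 x by unfold_locales (auto simp: trace_step_def)
  define A0 where "A0 = J \<inter> V0"
  have A0: "A0 \<in> Pow V0" by (simp add: A0_def)
  have compJ: "compact (closure J)"
    using boundary_class_subset_K[OF J] K_compact bounded_subset compact_imp_bounded
    by (metis compact_closure)
  obtain C where C: "\<And>n0. \<exists>(I :: nat set) U k. finite I \<and> closure J \<subseteq> (\<Union>i\<in>I. U i) \<and>
      (\<forall>i\<in>I. n0 \<le> k i \<and> (\<forall>y\<in>U i. \<forall>z\<in>U i. dist y z \<le> 3 * \<rho> ^ k i)) \<and>
      (\<Sum>i\<in>I. (\<rho> powr s) ^ k i) \<le> C"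
    using finite_hausdorff_cover[OF \<rho> s compJ fin] by metis
  obtain M where M: "\<forall>n U. (\<forall>y\<in>U. \<forall>z\<in>U. dist y z \<le> 3 * \<rho> ^ n) \<longrightarrow>
     card {w \<in> words N n. cell w \<inter> U \<noteq> {}} \<le> M"
    using bounded_overlap[of 3] ..
  have "\<exists>d. (aut.transfer ^^ m) (aut.content d) A0 \<le> real M * C" for m
  proof -
    obtain I :: "nat set" and U k where I: "finite I" "closure J \<subseteq> (\<Union>i\<in>I. U i)"
      and k: "\<And>i. i \<in> I \<Longrightarrow> m \<le> k i"
      and U: "\<And>i. i \<in> I \<Longrightarrow> \<forall>y\<in>U i. \<forall>z\<in>U i. dist y z \<le> 3 * \<rho> ^ k i"
      and sum: "(\<Sum>i\<in>I. x ^ k i) \<le> C"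
      using C[of m] unfolding x_def by blast
    define d where "d = (\<Sum>i\<in>I. k i)"
    define W where "W = (\<Union>i\<in>I. {w \<in> words N (k i). cell w \<inter> U i \<noteq> {}})"
    have "(aut.transfer ^^ m) (aut.content d) A0 \<le> (\<Sum>w\<in>W. x ^ length w)"
    proof (rule aut.transfer_content_le_cutset[OF _ _ _ A0])
      show "finite W" unfolding W_def using I(1) finite_words by auto
      show "m \<le> length w" if "w \<in> W" for w
        using that k by (auto simp: W_def words_def)
      show "\<exists>l. take l v \<in> W" if v: "v \<in> words N (m + d)" "fold trace_step v A0 \<noteq> {}" for v
      proof -
        have "cell_trace J v \<noteq> {}"
          using v cell_trace_fold[OF J words_set[OF v(1)]] by (simp add: A0_def)
        then obtain a where a: "a \<in> V0" "word_map F v a \<in> J" by (auto simp: cell_trace_def)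
        then obtain i where i: "i \<in> I" "word_map F v a \<in> U i"
          using I(2) closure_subset[of J] by blast
        have "k i \<le> d" unfolding d_def using I(1) i(1) by (intro member_le_sum) auto
        then have "take (k i) v \<in> words N (k i)" using take_words[OF v(1)] by simp
        moreover have "word_map F v a \<in> cell (take (k i) v)"
          using cell_take_subset[OF v(1)] a(1) V0_subset_K by blast
        ultimately show ?thesis using i unfolding W_def by blast
      qed
    qed
    also have "\<dots> \<le> (\<Sum>i\<in>I. \<Sum>w\<in>{w \<in> words N (k i). cell w \<inter> U i \<noteq> {}}. x ^ length w)"
      unfolding W_def using I(1) x finite_words by (intro sum_UNION_le) auto
    also have "\<dots> = (\<Sum>i\<in>I. real (card {w \<in> words N (k i). cell w \<inter> U i \<noteq> {}}) * x ^ k i)"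
      by (intro sum.cong refl) (simp add: words_def)
    also have "\<dots> \<le> (\<Sum>i\<in>I. real M * x ^ k i)"
    proof (intro sum_mono mult_right_mono)
      fix i assume "i \<in> I"
      then show "real (card {w \<in> words N (k i). cell w \<inter> U i \<noteq> {}}) \<le> real M"
        using M U of_nat_le_iff by blast
    qed (use x in auto)
    also have "\<dots> \<le> real M * C"
      using sum by (simp add: sum_distrib_left[symmetric] mult_left_mono)
    finally show ?thesis by blast
  qed
  then obtain B where B: "\<And>n. (aut.transfer ^^ n) (\<lambda>A. of_bool (A \<noteq> {})) A0 \<le> B"
    using aut.weighted_count_bounded[OF A0] by blast
  have "x ^ n * real (card {w \<in> words N n. J \<inter> Vcell F N K w \<noteq> {}}) \<le> B" for n
  proof -
    have "(J \<inter> Vcell F N K w \<noteq> {}) = (fold trace_step w A0 \<noteq> {})" if "w \<in> words N n" for w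
      using cell_trace_fold[OF J words_set[OF that]]
      unfolding A0_def by (auto simp: cell_trace_def Vcell_def)
    then have "real (card {w \<in> words N n. J \<inter> Vcell F N K w \<noteq> {}})
        = (\<Sum>w\<in>words N n. of_bool (fold trace_step w A0 \<noteq> {}))"
      using finite_words by (simp add: sum_of_bool_eq Int_def conj_commute cong: conj_cong)
    then show ?thesis using B[of n] unfolding aut.transfer_pow_words by simp
  qed
  then show ?thesis using that unfolding x_def by blast
qed

section \<open>The energy bound\<close>
lemma pair_energy_le:
  assumes "finite A" "\<And>x y. x \<in> A \<Longrightarrow> y \<in> A \<Longrightarrow> \<bar>u x - u y\<bar> \<le> c"
  shows "pair_energy A u \<le> (real (card A))\<^sup>2 * c\<^sup>2"
proof -
  have "(\<Sum>x\<in>A. \<Sum>y\<in>A. \<bar>u x - u y\<bar>\<^sup>2) \<le> (\<Sum>x\<in>A. \<Sum>y\<in>A. c\<^sup>2)"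
    using assms(2) by (intro sum_mono power_mono) auto
  also have "\<dots> = (real (card A))\<^sup>2 * c\<^sup>2" by (simp add: power2_eq_square)
  finally have "pair_energy A u \<le> (1/2) * ((real (card A))\<^sup>2 * c\<^sup>2)"
    unfolding pair_energy_def by simp
  also have "\<dots> \<le> (real (card A))\<^sup>2 * c\<^sup>2" by simp
  finally show ?thesis .
qed

text \<open>
Only the cells meeting \<open>J\<close> contribute, each at most \<open>c * \<rho>^(2n)\<close>.  The hypothesis on \<open>R\<close> says
\<open>R * \<rho>\<^sup>2 \<le> \<rho> powr s\<close>, so the factor \<open>(R * \<rho>\<^sup>2)^n\<close> is absorbed by the weight in \<open>class_cell_count\<close>.
\<close>
proposition class_energy_bounded:
  assumes J: "boundary_class F N K S J" and s: "0 \<le> s"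
    and fin: "hausdorff_measure s (closure J) < \<infinity>"
    and u: "L-lipschitz_on (closure J) u" and R: "0 < R" "R \<le> \<rho> powr (- (2 - s))"
  shows "(SUP n. ereal (R ^ n * class_energy F N K J n u)) < \<infinity>"
proof -
  obtain B where B: "\<And>n. (\<rho> powr s) ^ n * real (card {w \<in> words N n. J \<inter> Vcell F N K w \<noteq> {}}) \<le> B"
    using class_cell_count[OF J s fin] by blast
  define Dm where "Dm = diameter K"
  define c where "c = (real (card V0))\<^sup>2 * (L * Dm)\<^sup>2"
  have c: "0 \<le> c" by (simp add: c_def)
  have L: "0 \<le> L" using u by (rule lipschitz_on_nonneg)
  have "R ^ n * class_energy F N K J n u \<le> c * B" for n
  proof -
    let ?W = "{w \<in> words N n. J \<inter> Vcell F N K w \<noteq> {}}"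
    have pe: "pair_energy (J \<inter> Vcell F N K w) u \<le> c * (\<rho>\<^sup>2) ^ n" if w: "w \<in> words N n" for w
    proof -
      have fin_cell: "finite (Vcell F N K w)" using finite_V0 by (simp add: Vcell_def)
      have "\<bar>u y - u z\<bar> \<le> L * Dm * \<rho> ^ n" if "y \<in> J \<inter> Vcell F N K w" "z \<in> J \<inter> Vcell F N K w" for y z
      proof -
        have "y \<in> cell w" "z \<in> cell w" using that V0_subset_K unfolding Vcell_def by blast+
        then have "dist y z \<le> \<rho> ^ n * Dm" unfolding Dm_def by (rule cell_dist[OF w])
        moreover have "\<bar>u y - u z\<bar> \<le> L * dist y z"
          using lipschitz_onD[OF u, of y z] that closure_subset[of J] by (auto simp: dist_real_def)
        ultimately show ?thesis using L by (smt (verit) mult.assoc mult.commute mult_left_mono)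
      qed
      then have "pair_energy (J \<inter> Vcell F N K w) u
          \<le> (real (card (J \<inter> Vcell F N K w)))\<^sup>2 * (L * Dm * \<rho> ^ n)\<^sup>2"
        using fin_cell by (intro pair_energy_le) auto
      also have "\<dots> \<le> (real (card V0))\<^sup>2 * (L * Dm * \<rho> ^ n)\<^sup>2"
      proof -
        have "card (J \<inter> Vcell F N K w) \<le> card (Vcell F N K w)" using fin_cell by (intro card_mono) auto
        also have "\<dots> \<le> card V0" unfolding Vcell_def using finite_V0 by (rule card_image_le)
        finally show ?thesis by (intro mult_right_mono power_mono) auto
      qed
      also have "\<dots> = c * (\<rho>\<^sup>2) ^ n"
        by (simp add: c_def power_mult_distrib power_mult[symmetric] mult.commute)
      finally show ?thesis .
    qed
    have "class_energy F N K J n u = (\<Sum>w\<in>?W. pair_energy (J \<inter> Vcell F N K w) u)"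
      unfolding class_energy_def using finite_words
      by (intro sum.mono_neutral_right) (auto simp: pair_energy_def)
    also have "\<dots> \<le> (\<Sum>w\<in>?W. c * (\<rho>\<^sup>2) ^ n)" using pe by (intro sum_mono) auto
    finally have "class_energy F N K J n u \<le> c * (real (card ?W) * (\<rho>\<^sup>2) ^ n)"
      by (simp add: mult.left_commute)
    then have "R ^ n * class_energy F N K J n u \<le> R ^ n * (c * (real (card ?W) * (\<rho>\<^sup>2) ^ n))"
      using R by (intro mult_left_mono) auto
    also have "\<dots> = c * ((R * \<rho>\<^sup>2) ^ n * real (card ?W))"
      by (simp add: power_mult_distrib)
    also have "\<dots> \<le> c * ((\<rho> powr s) ^ n * real (card ?W))"
    proof -
      have "R * \<rho>\<^sup>2 \<le> \<rho> powr (- (2 - s)) * \<rho> powr 2"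
        using R \<rho> by (simp add: mult_right_mono powr_numeral)
      also have "\<dots> = \<rho> powr s" by (simp add: powr_add[symmetric])
      finally show ?thesis using R c \<rho> by (intro mult_left_mono mult_right_mono power_mono) auto
    qed
    also have "\<dots> \<le> c * B" using B c by (intro mult_left_mono) auto
    finally show ?thesis .
  qed
  then have "(SUP n. ereal (R ^ n * class_energy F N K J n u)) \<le> ereal (c * B)"
    by (intro SUP_least) simp
  then show ?thesis by (rule order_le_less_trans) simp
qed

end

theorem lemma3p4:
  fixes F :: "nat \<Rightarrow> 'a::euclidean_space \<Rightarrow> 'a"
    and b :: "nat \<Rightarrow> 'a" and N :: nat and \<rho> :: real
    and K J :: "'a set" and S :: "'a rel"
    and p q :: 'a and R \<gamma> :: real and u :: "'a \<Rightarrow> real"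
  assumes "0 < \<rho>" and "\<rho> < 1"
    and "\<And>i x. i \<in> {1..N} \<Longrightarrow> F i x = \<rho> *\<^sub>R (x - b i) + b i"
    and "K \<noteq> {}" and "compact K" and "K = (\<Union>i\<in>{1..N}. F i ` K)"
    and "connected K"
    and "pcf F N K"
    and "2 \<le> card (V F N K 0)"
    and "compatible F N K S"
    and "boundary_class F N K S J"
    and "\<gamma> = hausdorff_dim (closure J)"
    and "p \<in> V F N K 0" and "q \<in> V F N K 0" and "p \<noteq> q"
    and "has_growth_rate (\<lambda>n. trace_resistance F N K n p q) R"
    and "\<exists>L. L-lipschitz_on (closure J) u"
  shows "(R < \<rho> powr (- (2 - \<gamma>)) \<longrightarrow>
            (SUP n. ereal (R ^ n * class_energy F N K J n u)) < \<infinity>) \<and>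
         (hausdorff_measure \<gamma> (closure J) < \<infinity> \<and> R \<le> \<rho> powr (- (2 - \<gamma>)) \<longrightarrow>
            (SUP n. ereal (R ^ n * class_energy F N K J n u)) < \<infinity>)"
proof -
  interpret boundary_relation F b N \<rho> K S
  proof unfold_locales
    show "equiv (V F N K 0) S" using assms(10) unfolding compatible_def by blast
  qed (fact assms)+
  note J = assms(11)
  have R: "0 < R" using assms(16) unfolding has_growth_rate_def by linarith
  obtain L where L: "L-lipschitz_on (closure J) u" using assms(17) by blast
  have sub: "closure J \<subseteq> K"
    using boundary_class_subset_K[OF J] compact_imp_closed[OF K_compact] by (rule closure_minimal)
  show ?thesis
  proof (intro conjI impI)
    assume less: "R < \<rho> powr (- (2 - \<gamma>))"
    (* The critical exponent: R is at most \<rho> powr (- (2 - s)) exactly for s up to t. *)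
    define t where "t = 2 + ln R / ln \<rho>"
    have ln: "ln \<rho> < 0" using \<rho> by simp
    have R_eq: "R = \<rho> powr (t - 2)" using R \<rho> ln by (simp add: t_def powr_def)
    have "ln R < (\<gamma> - 2) * ln \<rho>" using less R \<rho> by (metis ln_less_cancel_iff ln_powr minus_diff_eq powr_gt_zero less_irrefl)
    then have "\<gamma> < t" using ln by (simp add: t_def field_simps)
    then obtain s where s: "0 \<le> s" "s < t" "hausdorff_measure s (closure J) = 0"
      using ex_null_exponent_near_dim[OF sub] assms(12) by blast
    have "R \<le> \<rho> powr (- (2 - s))" unfolding R_eq using s \<rho> by (intro powr_mono') auto
    then show "(SUP n. ereal (R ^ n * class_energy F N K J n u)) < \<infinity>"
      using s by (intro class_energy_bounded[OF J s(1) _ L R]) auto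
  next
    assume "hausdorff_measure \<gamma> (closure J) < \<infinity> \<and> R \<le> \<rho> powr (- (2 - \<gamma>))"
    then show "(SUP n. ereal (R ^ n * class_energy F N K J n u)) < \<infinity>"
      using hausdorff_dim_ge_0[OF sub] assms(12) by (intro class_energy_bounded[OF J _ _ L R]) auto
  qed
qed

end
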